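(* Let $B$ be a compact Riemann surface with a Riemannian metric $\rho$, let $\overline\Delta_1,\dots,\overline\Delta_t\subset B$ ($t\ge 1$) be pairwise disjoint disks, let $B_0:=B\smallsetminus\bigsqcup_{i=1}^t\overline\Delta_i$, and let $b_0\in B_0$. Fix a loop $\alpha\subset B_0$ representing a nontrivial class in $\pi_1(B_0,b_0)$. Then there exists $C>0$, depending only on $\alpha$, $B_0$ and $\rho$, such that $$L(\alpha,s)\le C\sqrt{(s+1)\log(s+2)}\qquad\text{for all integers }s\ge 0.$$
   Context: A (closed topological) disk in $B$ is a closed subset of $B$ homeomorphic to the closed unit disk in $\mathbb C$, with piecewise-$C^1$ boundary. Compact Riemann surfaces are connected. For a connected complex manifold $X$, with real tangent bundle $TX$ viewed as a complex vector bundle via the complex structure, the Kobayashi--Royden pseudo-metric is $$\kappa_X(x,v):=\inf\left\{\tfrac{2}{R}:R>0,\ \exists\,f\colon\Delta(0,R)\to X\text{ holomorphic with }f(0)=x,\ f'(0)=v\right\},$$ where $\Delta(0,R)\subset\mathbb C$ is the open disk of radius $R$ centered at $0$. Paths and loops are piecewise $C^1$. For a finite set $S\subset B_0$ (possibly empty), $\kappa_S$ denotes the Kobayashi--Royden metric of the hyperbolic surface $B_0\smallsetminus S$, and for a path $\gamma\colon[0,1]\to B_0\smallsetminus S$, $\ell_S(\gamma):=\int_0^1\kappa_S(\gamma(t),\gamma'(t))\,dt$. Let $\Gamma^\alpha_S$ be the set of loops in $B_0\smallsetminus S$ that are freely homotopic to $\alpha$ in $B_0$ (the homotopy is in $B_0$,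 not necessarily in $B_0\smallsetminus S$). Define $$L(\alpha,s):=\sup_{S\subset B_0,\ \#S\le s}\ \inf\{\ell_S(\gamma):\gamma\in\Gamma^\alpha_S\}.$$ *)

theory Defs
  imports "HOL-Analysis.Analysis"
begin

section \<open>Riemann surfaces\<close>

text \<open>
  A chart is a pair of its domain \<open>U\<close> and a map \<open>\<phi>\<close>, which is a total function but only meaningful
  on \<open>U\<close>. A Riemann surface is a connected subspace \<open>X\<close> of a Hausdorff space together with a
  (not necessarily maximal) holomorphic atlas.
\<close>

type_synonym 'a chart = "'a set \<times> ('a \<Rightarrow> complex)"

definition riemann_surface :: "'a::t2_space set \<Rightarrow> 'a chart set \<Rightarrow> bool" where
  "riemann_surface X A \<longleftrightarrow>
     connected X \<and> X \<noteq> {} \<and>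
     (\<Union>(U, \<phi>)\<in>A. U) = X \<and>
     (\<forall>(U, \<phi>)\<in>A. openin (top_of_set X) U \<and> open (\<phi> ` U) \<and>
        homeomorphism U (\<phi> ` U) \<phi> (inv_into U \<phi>)) \<and>
     (\<forall>(U, \<phi>)\<in>A. \<forall>(V, \<psi>)\<in>A. (\<psi> \<circ> inv_into U \<phi>) holomorphic_on (\<phi> ` (U \<inter> V)))"

text \<open>The atlas induced on an open subset \<open>Y\<close>.\<close>

definition restrict_atlas :: "'a set \<Rightarrow> 'a chart set \<Rightarrow> 'a chart set" where
  "restrict_atlas Y A = (\<lambda>(U, \<phi>). (U \<inter> Y, \<phi>)) ` A"

definition chart_at :: "'a chart set \<Rightarrow> 'a \<Rightarrow> ('a \<Rightarrow> complex) \<Rightarrow> bool" where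
  "chart_at A x \<phi> \<longleftrightarrow> (\<exists>U. (U, \<phi>) \<in> A \<and> x \<in> U)"


section \<open>Tangent vectors\<close>

text \<open>
  A tangent vector at \<open>x\<close> assigns to each chart at \<open>x\<close> its coordinate in that chart; coordinates
  transform by the derivative of the transition map, and the value is \<open>0\<close> at maps which are not
  charts at \<open>x\<close>. Vectors are indexed by the chart map alone (not by the domain), so that for an
  open subset \<open>Y\<close> containing \<open>x\<close> the tangent spaces for \<open>A\<close> and \<open>restrict_atlas Y A\<close> are the same set.
\<close>

type_synonym 'a tangent = "('a \<Rightarrow> complex) \<Rightarrow> complex"

definition tangent_space :: "'a chart set \<Rightarrow> 'a \<Rightarrow> 'a tangent set" where
  "tangent_space A x =
     {v. (\<forall>(U, \<phi>)\<in>A. \<forall>(V, \<psi>)\<in>A. x \<in> U \<inter> V \<longrightarrow>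
            v \<psi> = deriv (\<psi> \<circ> inv_into U \<phi>) (\<phi> x) * v \<phi>) \<and>
         (\<forall>\<phi>. \<not> chart_at A x \<phi> \<longrightarrow> v \<phi> = 0)}"

text \<open>The tangent vector at \<open>x\<close> whose coordinate in the chart \<open>(U, \<phi>)\<close> is \<open>c\<close>.\<close>

definition coord_vector :: "'a chart set \<Rightarrow> 'a chart \<Rightarrow> 'a \<Rightarrow> complex \<Rightarrow> 'a tangent" where
  "coord_vector A = (\<lambda>(U, \<phi>) x c \<psi>.
     if chart_at A x \<psi> then deriv (\<psi> \<circ> inv_into U \<phi>) (\<phi> x) * c else 0)"


section \<open>Riemannian metrics\<close>

primrec C_k_on :: "nat \<Rightarrow> ('b::real_normed_vector \<Rightarrow> 'c::real_normed_vector) \<Rightarrow> 'b set \<Rightarrow> bool" where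
  "C_k_on 0 f S \<longleftrightarrow> continuous_on S f"
| "C_k_on (Suc k) f S \<longleftrightarrow>
     (\<forall>x\<in>S. f differentiable (at x)) \<and>
     (\<forall>v. C_k_on k (\<lambda>x. frechet_derivative f (at x) v) S)"

definition smooth_on :: "('b::real_normed_vector \<Rightarrow> 'c::real_normed_vector) \<Rightarrow> 'b set \<Rightarrow> bool" where
  "smooth_on f S \<longleftrightarrow> (\<forall>k. C_k_on k f S)"

text \<open>
  A smooth family of (real) inner products on the tangent spaces; no compatibility with the complex
  structure is required. By bilinearity the last clause says that the metric coefficients
  in every chart are smooth.
\<close>

definition riemannian_metric ::
  "'a set \<Rightarrow> 'a chart set \<Rightarrow> ('a \<Rightarrow> 'a tangent \<Rightarrow> 'a tangent \<Rightarrow> real) \<Rightarrow> bool" where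
  "riemannian_metric X A \<rho> \<longleftrightarrow>
     (\<forall>x\<in>X. \<forall>u\<in>tangent_space A x. \<forall>v\<in>tangent_space A x.
        \<rho> x u v = \<rho> x v u \<and>
        (\<forall>w\<in>tangent_space A x. \<forall>a b::real.
           \<rho> x (\<lambda>\<phi>. of_real a * u \<phi> + of_real b * v \<phi>) w = a * \<rho> x u w + b * \<rho> x v w)) \<and>
     (\<forall>x\<in>X. \<forall>v\<in>tangent_space A x. v \<noteq> (\<lambda>_. 0) \<longrightarrow> \<rho> x v v > 0) \<and>
     (\<forall>(U, \<phi>)\<in>A. \<forall>c d.
        smooth_on (\<lambda>z. let x = inv_into U \<phi> z in
            \<rho> x (coord_vector A (U, \<phi>) x c) (coord_vector A (U, \<phi>) x d)) (\<phi> ` U))"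


section \<open>Piecewise continuously differentiable paths and disks\<close>

definition C1_curve_on :: "'a chart set \<Rightarrow> real \<Rightarrow> real \<Rightarrow> (real \<Rightarrow> 'a) \<Rightarrow> bool" where
  "C1_curve_on A a b \<gamma> \<longleftrightarrow>
     (\<forall>(U, \<phi>)\<in>A. \<exists>d.
        continuous_on {\<tau>\<in>{a..b}. \<gamma> \<tau> \<in> U} d \<and>
        (\<forall>\<tau>\<in>{a..b}. \<gamma> \<tau> \<in> U \<longrightarrow> ((\<phi> \<circ> \<gamma>) has_vector_derivative d \<tau>) (at \<tau> within {a..b})))"

text \<open>
  In contrast to \<^const>\<open>piecewise_C1_differentiable_on\<close>, the derivative extends continuously to the
  closed pieces.
\<close>

definition pw_C1_path :: "'a::topological_space set \<Rightarrow> 'a chart set \<Rightarrow> (real \<Rightarrow> 'a) \<Rightarrow> bool" where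
  "pw_C1_path X A \<gamma> \<longleftrightarrow>
     path \<gamma> \<and> path_image \<gamma> \<subseteq> X \<and>
     (\<exists>n (p :: nat \<Rightarrow> real). p 0 = 0 \<and> p n = 1 \<and>
        (\<forall>i<n. p i < p (Suc i) \<and> C1_curve_on A (p i) (p (Suc i)) \<gamma>))"

definition pw_C1_loop :: "'a::topological_space set \<Rightarrow> 'a chart set \<Rightarrow> (real \<Rightarrow> 'a) \<Rightarrow> bool" where
  "pw_C1_loop X A \<gamma> \<longleftrightarrow> pw_C1_path X A \<gamma> \<and> pathfinish \<gamma> = pathstart \<gamma>"

definition velocity :: "'a chart set \<Rightarrow> (real \<Rightarrow> 'a) \<Rightarrow> real \<Rightarrow> 'a tangent" where
  "velocity A \<gamma> \<tau> = (\<lambda>\<phi>.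
     if chart_at A (\<gamma> \<tau>) \<phi> then vector_derivative (\<phi> \<circ> \<gamma>) (at \<tau> within {0..1}) else 0)"

definition closed_disk :: "'a::topological_space set \<Rightarrow> 'a chart set \<Rightarrow> 'a set \<Rightarrow> bool" where
  "closed_disk X A D \<longleftrightarrow>
     closedin (top_of_set X) D \<and> D homeomorphic (cball 0 1 :: complex set) \<and>
     (\<exists>c. pw_C1_loop X A c \<and> simple_path c \<and> path_image c = (top_of_set X) frontier_of D)"


section \<open>The Kobayashi--Royden pseudo-metric\<close>

definition holomorphic_curve ::
  "complex set \<Rightarrow> 'a::topological_space set \<Rightarrow> 'a chart set \<Rightarrow> (complex \<Rightarrow> 'a) \<Rightarrow> bool" where
  "holomorphic_curve G X A f \<longleftrightarrow>
     continuous_on G f \<and> f ` G \<subseteq> X \<and>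
     (\<forall>(U, \<phi>)\<in>A. (\<phi> \<circ> f) holomorphic_on {z\<in>G. f z \<in> U})"

definition curve_deriv :: "'a chart set \<Rightarrow> (complex \<Rightarrow> 'a) \<Rightarrow> complex \<Rightarrow> 'a tangent" where
  "curve_deriv A f z = (\<lambda>\<phi>. if chart_at A (f z) \<phi> then deriv (\<phi> \<circ> f) z else 0)"

definition kobayashi_royden ::
  "'a::topological_space set \<Rightarrow> 'a chart set \<Rightarrow> 'a \<Rightarrow> 'a tangent \<Rightarrow> ennreal" where
  "kobayashi_royden X A x v =
     Inf {ennreal (2 / R) | R. R > 0 \<and>
       (\<exists>f. holomorphic_curve (ball 0 R) X A f \<and> f 0 = x \<and> curve_deriv A f 0 = v)}"

text \<open>
  In the following, \<open>A\<close> is an atlas of a Riemann surface of which \<open>B\<^sub>0\<close> is an open subset.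
  Lengths, their infima and the supremum are taken in \<open>[0, \<infinity>]\<close>, so that they are
  meaningful without any prior finiteness statement.
\<close>

definition kr_length ::
  "'a::topological_space set \<Rightarrow> 'a chart set \<Rightarrow> 'a set \<Rightarrow> (real \<Rightarrow> 'a) \<Rightarrow> ennreal" where
  "kr_length B\<^sub>0 A S \<gamma> =
     (let A' = restrict_atlas (B\<^sub>0 - S) A in
      \<integral>\<^sup>+ \<tau>\<in>{0..1}. kobayashi_royden (B\<^sub>0 - S) A' (\<gamma> \<tau>) (velocity A' \<gamma> \<tau>) \<partial>lborel)"

definition homotopic_loop_class ::
  "'a::topological_space set \<Rightarrow> 'a chart set \<Rightarrow> 'a set \<Rightarrow> (real \<Rightarrow> 'a) \<Rightarrow> (real \<Rightarrow> 'a) set" where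
  "homotopic_loop_class B\<^sub>0 A S \<alpha> =
     {\<gamma>. pw_C1_loop (B\<^sub>0 - S) (restrict_atlas (B\<^sub>0 - S) A) \<gamma> \<and> homotopic_loops B\<^sub>0 \<gamma> \<alpha>}"

definition max_min_length ::
  "'a::topological_space set \<Rightarrow> 'a chart set \<Rightarrow> (real \<Rightarrow> 'a) \<Rightarrow> nat \<Rightarrow> ennreal" where
  "max_min_length B\<^sub>0 A \<alpha> s =
     (SUP S\<in>{S. S \<subseteq> B\<^sub>0 \<and> finite S \<and> card S \<le> s}.
        INF \<gamma>\<in>homotopic_loop_class B\<^sub>0 A S \<alpha>. kr_length B\<^sub>0 A S \<gamma>)"

end

theory Submission
  imports Defs "HOL-Complex_Analysis.Conformal_Mappings"
begin

text \<open>
  The idea is to thicken \<open>\<alpha>\<close> to a two-real-parameter family of loops, all freely homotopic to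
  \<open>\<alpha>\<close> in \<open>B\<^sub>0\<close>, and to show that for every puncture set \<open>S\<close> the average length of a member of
  the family is at most \<open>C * sqrt (s + 1)\<close>. Some member is then as short as that, and
  \<open>ln (s + 2) \<ge> ln 2\<close> absorbs the difference to the bound that is claimed.

  \<^bold>\<open>The family.\<close> It is a continuous map \<open>\<Gamma>\<close> of \<open>(w, t)\<close>, where \<open>w\<close> ranges over a small closed
  disk of \<open>\<complex>\<close> around \<open>0\<close> and \<open>t\<close> over \<open>[0, 1]\<close>, with \<open>\<Gamma> 0 = \<alpha>\<close> and with every \<open>\<Gamma> w\<close> a loop.
  Shrinking \<open>w\<close> to \<open>0\<close> is a homotopy from \<open>\<Gamma> w\<close> to \<open>\<alpha>\<close> (\<open>homotopic_loops_swept\<close>). The interval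
  is cut into pieces, each mapped by \<open>\<Gamma>\<close> into one chart, and on each piece, for every fixed \<open>t\<close>,
  the map \<open>w \<mapsto> \<Gamma> w t\<close> expands distances in that chart at least by a constant \<open>c > 0\<close>.

  \<^bold>\<open>The average.\<close> A round coordinate disk that avoids \<open>S\<close> shows that the Kobayashi--Royden metric
  at a point with coordinate \<open>z\<close> is bounded by a constant plus a constant over the distance of \<open>z\<close>
  to the coordinates of \<open>S\<close> (\<open>kobayashi_royden_le\<close>). Put \<open>r = 1 / sqrt (s + 1)\<close>. Distances that
  exceed \<open>r\<close> contribute at most \<open>1 / r = sqrt (s + 1)\<close>. A puncture \<open>q\<close> contributes to the average
  the integral of \<open>1 / |z - q|\<close> over the disk of radius \<open>r\<close>, which is of order \<open>r\<close> in two real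
  dimensions; \<open>w \<mapsto> \<Gamma> w t\<close> being expanding, the same order holds for the integral over \<open>w\<close>. The
  \<open>s\<close> punctures contribute \<open>s * r \<le> sqrt (s + 1)\<close>, and Tonelli's theorem gives the average
  (\<open>short_on_average_chart_sweep\<close>). As \<open>1 / |z - q|\<close> is not integrable along a curve of bounded
  speed through \<open>q\<close>, a member of finite bound avoids \<open>S\<close>.

  \<^bold>\<open>Construction of the family.\<close> Along an arc of \<open>\<alpha>\<close> inside one chart \<open>\<phi>\<close>, local holomorphic
  parameters at the two end points become germs \<open>k0\<close>, \<open>k1\<close> of biholomorphic maps of \<open>\<complex>\<close> fixing
  \<open>0\<close>. Because \<open>\<complex> - {0}\<close> is path connected, their linear parts can be joined within the invertible
  linear maps, and up to a small Lipschitz error this joins the germs themselves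
  (\<open>interpolate_germs\<close>). Adding the result to \<open>\<phi> \<circ> \<alpha>\<close> gives a piece of the family with
  prescribed parameters at both ends (\<open>chart_sweep_exists\<close>). Pieces are glued by prescribing a
  common parameter where they meet, and the family consists of loops when the same parameter is
  prescribed at \<open>t = 0\<close> and \<open>t = 1\<close>.
\<close>


section \<open>An integrable majorant of the reciprocal distance\<close>

text \<open>
  A majorant of \<open>1 / |z|\<close> on the disk of radius \<open>r\<close> that vanishes outside. Being a series of
  multiples of indicator functions of disks, it is integrated by computing areas, and it has the
  value \<open>\<infinity>\<close> at \<open>0\<close>, where real division would give \<open>1 / 0 = 0\<close>.
\<close>

definition dyadic_reciprocal :: "real \<Rightarrow> complex \<Rightarrow> ennreal" where
  "dyadic_reciprocal r z = (\<Sum>k. ennreal (2 ^ Suc k / r) * indicator (ball 0 (r / 2 ^ k)) z)"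

lemma measurable_dyadic_reciprocal [measurable]:
  "dyadic_reciprocal r \<in> borel_measurable borel"
  unfolding dyadic_reciprocal_def
  by (intro borel_measurable_suminf_order borel_measurable_times_ennreal borel_measurable_indicator)
     auto

lemma reciprocal_le_dyadic_reciprocal:
  assumes "z \<noteq> 0" "norm z < r"
  shows "ennreal (1 / norm z) \<le> dyadic_reciprocal r z"
proof -
  have r: "r > 0" using assms(2) norm_ge_zero[of z] by linarith
  have "(\<lambda>k. r * (1/2) ^ k) \<longlonglongrightarrow> r * 0"
    by (intro tendsto_intros LIMSEQ_power_zero) auto
  then have "eventually (\<lambda>k. r * (1/2) ^ k < norm z) sequentially"
    using assms(1) by (auto simp: order_tendsto_iff)
  then have ex: "\<exists>k. r / 2 ^ k \<le> norm z"
    by (auto simp: eventually_sequentially power_one_over intro: less_imp_le)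
  define m where "m = (LEAST k. r / 2 ^ k \<le> norm z)"
  have m: "r / 2 ^ m \<le> norm z" using LeastI_ex[OF ex] by (simp add: m_def)
  have "m \<noteq> 0" using m assms(2) by (intro notI) auto
  then obtain k where k: "m = Suc k" using not0_implies_Suc by blast
  have k': "norm z < r / 2 ^ k" using not_less_Least[of k "\<lambda>k. r / 2 ^ k \<le> norm z"] k
    by (auto simp: m_def)
  have "1 / norm z \<le> 2 ^ Suc k / r"
    using m r assms(1) by (simp add: k field_simps)
  then have "ennreal (1 / norm z) \<le> ennreal (2 ^ Suc k / r) * indicator (ball 0 (r / 2 ^ k)) z"
    using k' by (simp add: ennreal_leI)
  also have "\<dots> \<le> dyadic_reciprocal r z"
    unfolding dyadic_reciprocal_def
    using sum_le_suminf[OF summableI, of "{k}" "\<lambda>k. ennreal (2 ^ Suc k / r) * indicator (ball 0 (r / 2 ^ k)) z"]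
    by (simp del: sum_mult_indicator sum.If_cases)
  finally show ?thesis .
qed

text \<open>
  Two parameters \<open>w\<close> with \<open>g w\<close> in the disk of radius \<open>r / 2 ^ k\<close> around \<open>q\<close> are at distance at
  most \<open>2 * r / (c * 2 ^ k)\<close>, so the area of these \<open>w\<close> is of order \<open>(r / 2 ^ k)\<^sup>2\<close>, while the
  \<open>k\<close>-th coefficient of the majorant is of order \<open>2 ^ k / r\<close>. The products form a geometric
  series of order \<open>r\<close>.
\<close>

lemma nn_integral_dyadic_reciprocal_le:
  fixes g :: "complex \<Rightarrow> complex"
  assumes c: "c > 0" and r: "r > 0"
    and g: "continuous_on (cball 0 \<delta>) g"
    and expand: "\<And>w w'. w \<in> cball 0 \<delta> \<Longrightarrow> w' \<in> cball 0 \<delta> \<Longrightarrow> c * norm (w - w') \<le> norm (g w - g w')"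
  shows "(\<integral>\<^sup>+ w. dyadic_reciprocal r (g w - q) * indicator (cball 0 \<delta>) w \<partial>lborel)
           \<le> ennreal (16 * pi * r / c\<^sup>2)"
proof -
  define E where "E k = {w \<in> cball 0 \<delta>. norm (g w - q) < r / 2 ^ k}" for k :: nat
  have gm[measurable]: "(\<lambda>w. g w * indicator (cball 0 \<delta>) w) \<in> borel_measurable borel"
    using borel_measurable_continuous_on_indicator[OF _ g]
    by (rule back_subst[where P = "\<lambda>h. h \<in> borel_measurable borel"]) (auto simp: indicator_def)
  have E_eq: "E k = cball 0 \<delta> \<inter> (\<lambda>w. g w * indicator (cball 0 \<delta>) w) -` ball q (r / 2 ^ k)" for k
    by (auto simp: E_def dist_norm norm_minus_commute)
  have Em[measurable]: "E k \<in> sets borel" for k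
    unfolding E_eq by (intro sets.Int measurable_sets_borel[OF gm]) auto
  have small: "emeasure lborel (E k) \<le> ennreal (4 * pi * r\<^sup>2 / c\<^sup>2 / 4 ^ k)" for k
  proof (cases "E k = {}")
    case False
    then obtain w0 where w0: "w0 \<in> E k" by auto
    have "E k \<subseteq> cball w0 (2 * r / (c * 2 ^ k))"
    proof
      fix w assume w: "w \<in> E k"
      have "c * norm (w - w0) \<le> norm (g w - g w0)"
        using expand w w0 by (auto simp: E_def)
      also have "\<dots> \<le> norm (g w - q) + norm (g w0 - q)"
        using norm_triangle_ineq4[of "g w - q" "g w0 - q"] by simp
      also have "\<dots> \<le> 2 * (r / 2 ^ k)" using w w0 by (auto simp: E_def)
      finally show "w \<in> cball w0 (2 * r / (c * 2 ^ k))"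
        using c by (simp add: dist_norm norm_minus_commute field_simps)
    qed
    then have "emeasure lborel (E k) \<le> emeasure lborel (cball w0 (2 * r / (c * 2 ^ k)))"
      by (intro emeasure_mono) auto
    also have "\<dots> = ennreal (pi * (2 * r / (c * 2 ^ k))\<^sup>2)"
      using r c by (subst emeasure_cball) (auto simp: unit_ball_vol_2)
    also have "pi * (2 * r / (c * 2 ^ k))\<^sup>2 = 4 * pi * r\<^sup>2 / c\<^sup>2 / 4 ^ k"
      by (simp add: power_mult_distrib power_divide power_even_eq[symmetric] power_mult[symmetric] mult.commute[of k 2])
         (simp add: power_mult)
    finally show ?thesis .
  qed simp
  have "(\<integral>\<^sup>+ w. dyadic_reciprocal r (g w - q) * indicator (cball 0 \<delta>) w \<partial>lborel)
      = (\<integral>\<^sup>+ w. (\<Sum>k. ennreal (2 ^ Suc k / r) * indicator (E k) w) \<partial>lborel)"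
    unfolding dyadic_reciprocal_def ennreal_suminf_multc[symmetric]
    by (intro nn_integral_cong arg_cong[where f = suminf] ext)
       (auto simp: E_def indicator_def)
  also have "\<dots> = (\<Sum>k. ennreal (2 ^ Suc k / r) * emeasure lborel (E k))"
    by (subst nn_integral_suminf) (auto simp: nn_integral_cmult_indicator)
  also have "\<dots> \<le> (\<Sum>k. ennreal (8 * pi * r / c\<^sup>2 * (1/2) ^ k))"
  proof (intro suminf_le summableI)
    fix k
    have "ennreal (2 ^ Suc k / r) * emeasure lborel (E k)
        \<le> ennreal (2 ^ Suc k / r) * ennreal (4 * pi * r\<^sup>2 / c\<^sup>2 / 4 ^ k)"
      by (intro mult_left_mono small) auto
    also have "\<dots> = ennreal (2 ^ Suc k / r * (4 * pi * r\<^sup>2 / c\<^sup>2 / 4 ^ k))"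
      using r by (intro ennreal_mult[symmetric]) auto
    also have "2 ^ Suc k / r * (4 * pi * r\<^sup>2 / c\<^sup>2 / 4 ^ k) = 8 * pi * r / c\<^sup>2 * (1/2) ^ k"
    proof -
      have "(4::real) ^ k = 2 ^ k * 2 ^ k" by (simp add: power_mult_distrib[symmetric])
      then show ?thesis using r c by (simp add: field_simps power2_eq_square)
    qed
    finally show "ennreal (2 ^ Suc k / r) * emeasure lborel (E k) \<le> ennreal (8 * pi * r / c\<^sup>2 * (1/2) ^ k)" .
  qed
  also have "\<dots> = ennreal (8 * pi * r / c\<^sup>2 * 2)"
  proof (intro suminf_ennreal_eq)
    show "0 \<le> 8 * pi * r / c\<^sup>2 * (1/2) ^ k" for k using r by simp
    show "(\<lambda>k. 8 * pi * r / c\<^sup>2 * (1/2) ^ k) sums (8 * pi * r / c\<^sup>2 * 2)"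
      using geometric_sums[of "1/2::real"] by (intro sums_mult) auto
  qed
  also have "8 * pi * r / c\<^sup>2 * 2 = 16 * pi * r / c\<^sup>2" by simp
  finally show ?thesis .
qed

text \<open>
  A curve of speed at most \<open>K\<close> stays in the disk of radius \<open>r / 2 ^ k\<close> around \<open>f t0\<close> for a time of
  order \<open>1 / 2 ^ k\<close>, so all terms of the series contribute at least the same positive amount.
\<close>

lemma nn_integral_dyadic_reciprocal_eq_top:
  fixes f :: "real \<Rightarrow> complex"
  assumes K: "K > 0" and r: "r > 0" and ab: "a < b"
    and lip: "\<And>t t'. t \<in> {a..b} \<Longrightarrow> t' \<in> {a..b} \<Longrightarrow> norm (f t - f t') \<le> K * \<bar>t - t'\<bar>"
    and t0: "t0 \<in> {a..b}"
  shows "(\<integral>\<^sup>+ t. dyadic_reciprocal r (f t - f t0) * indicator {a..b} t \<partial>lborel) = top"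
proof -
  define m where "m = min (r / K) ((b - a) / 2)"
  have m: "m > 0" "m \<le> r / K" "m \<le> (b - a) / 2" using K r ab by (auto simp: m_def min_def)
  \<comment> \<open>\<open>J k\<close> lies on the side of \<open>t0\<close> on which at least half of \<open>[a, b]\<close> is left.\<close>
  define J where "J k = (if t0 \<le> (a + b) / 2 then {t0<..<t0 + m / 2 ^ k} else {t0 - m / 2 ^ k<..<t0})" for k :: nat
  have mk: "m / 2 ^ k \<le> m" for k using m(1) by (simp add: field_simps)
  have J_sub: "J k \<subseteq> {a..b}" for k
  proof
    fix t assume "t \<in> J k"
    then have "\<bar>t - t0\<bar> < m / 2 ^ k \<and> (if t0 \<le> (a + b) / 2 then t0 < t else t < t0)"
      by (simp only: J_def split: if_splits) auto
    then show "t \<in> {a..b}"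
      using mk[of k] m(3) t0 unfolding atLeastAtMost_iff by argo
  qed
  have J_near: "norm (f t - f t0) < r / 2 ^ k" if "t \<in> J k" for t k
  proof -
    have "norm (f t - f t0) \<le> K * \<bar>t - t0\<bar>" using lip that J_sub t0 by blast
    also have "\<dots> < K * (m / 2 ^ k)"
      using that K by (intro mult_strict_left_mono) (auto simp: J_def split: if_splits)
    also have "\<dots> \<le> K * (r / K / 2 ^ k)"
      using m(2) K by (intro mult_left_mono divide_right_mono) auto
    finally show ?thesis using K by simp
  qed
  have J_len: "emeasure lborel (J k) = ennreal (m / 2 ^ k)" for k
    using m(1) by (auto simp: J_def)
  have Jm [measurable]: "J k \<in> sets borel" for k by (auto simp: J_def)
  have "(top::ennreal) = (\<Sum>k::nat. ennreal (2 * m / r))"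
  proof -
    have le: "ennreal (real n * (2 * m / r)) \<le> (\<Sum>k::nat. ennreal (2 * m / r))" for n :: nat
    proof -
      have "ennreal (real n * (2 * m / r)) = of_nat n * ennreal (2 * m / r)"
        using m(1) r unfolding ennreal_of_nat_eq_real_of_nat by (intro ennreal_mult) auto
      also have "\<dots> = (\<Sum>k<n. ennreal (2 * m / r))" by simp
      also have "\<dots> \<le> (\<Sum>k::nat. ennreal (2 * m / r))"
        by (rule sum_le_suminf[OF summableI]) auto
      finally show ?thesis .
    qed
    show ?thesis
    proof (rule ccontr)
      assume "top \<noteq> (\<Sum>k::nat. ennreal (2 * m / r))"
      then obtain x where x: "x \<ge> 0" "(\<Sum>k::nat. ennreal (2 * m / r)) = ennreal x"
        by (metis ennreal_cases)
      obtain n :: nat where "x < real n * (2 * m / r)"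
        using reals_Archimedean3[of "2 * m / r"] m r by auto
      then show False using le[of n] x by (simp add: ennreal_le_iff)
    qed
  qed
  also have "\<dots> = (\<Sum>k. ennreal (2 ^ Suc k / r) * emeasure lborel (J k))"
    unfolding J_len using m r by (intro arg_cong[where f = suminf] ext) (simp add: ennreal_mult[symmetric])
  also have "\<dots> = (\<integral>\<^sup>+ t. (\<Sum>k. ennreal (2 ^ Suc k / r) * indicator (J k) t) \<partial>lborel)"
    by (subst nn_integral_suminf) (auto simp: nn_integral_cmult_indicator)
  also have "\<dots> \<le> (\<integral>\<^sup>+ t. dyadic_reciprocal r (f t - f t0) * indicator {a..b} t \<partial>lborel)"
    unfolding dyadic_reciprocal_def ennreal_suminf_multc[symmetric]
    using J_near J_sub[THEN subsetD]
    by (intro nn_integral_mono suminf_le summableI) (auto simp: indicator_def)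
  finally show ?thesis by (simp add: top_unique)
qed


section \<open>Curves and holomorphic disks in charts\<close>

lemma chart_at_restrict_atlas_iff:
  "chart_at (restrict_atlas Y A) x \<psi> \<longleftrightarrow> x \<in> Y \<and> chart_at A x \<psi>"
  unfolding chart_at_def restrict_atlas_def by auto

locale open_part_of_surface =
  fixes B B\<^sub>0 :: "'a::t2_space set" and A :: "'a chart set"
  assumes surface: "riemann_surface B A"
    and open_part: "openin (top_of_set B) B\<^sub>0"
begin

lemma chart:
  assumes "(U, \<phi>) \<in> A"
  shows "openin (top_of_set B) U" "open (\<phi> ` U)" "homeomorphism U (\<phi> ` U) \<phi> (inv_into U \<phi>)"
proof -
  have "\<forall>(U, \<phi>)\<in>A. openin (top_of_set B) U \<and> open (\<phi> ` U) \<and>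
      homeomorphism U (\<phi> ` U) \<phi> (inv_into U \<phi>)"
    using surface unfolding riemann_surface_def by (elim conjE)
  from bspec[OF this assms]
  show "openin (top_of_set B) U" "open (\<phi> ` U)" "homeomorphism U (\<phi> ` U) \<phi> (inv_into U \<phi>)"
    by simp_all
qed

lemma inv_chart:
  assumes "(U, \<phi>) \<in> A" "x \<in> U"
  shows "inv_into U \<phi> (\<phi> x) = x"
  using chart(3)[OF assms(1)] assms(2) by (simp add: homeomorphism_def)

lemma chart_inv:
  assumes "(U, \<phi>) \<in> A" "z \<in> \<phi> ` W" "W \<subseteq> U"
  shows "inv_into U \<phi> z \<in> W" "\<phi> (inv_into U \<phi> z) = z"
proof -
  obtain x where x: "x \<in> W" "z = \<phi> x" using assms(2) by blast
  then have "inv_into U \<phi> z = x" using inv_chart[OF assms(1)] assms(3) by blast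
  then show "inv_into U \<phi> z \<in> W" "\<phi> (inv_into U \<phi> z) = z" using x by simp_all
qed

lemma open_chart_image:
  assumes "(U, \<phi>) \<in> A" "openin (top_of_set B) W"
  shows "open (\<phi> ` (U \<inter> W))"
proof -
  have "openin (top_of_set U) (U \<inter> W)"
    using openin_subset_trans[OF openin_Int[OF chart(1)[OF assms(1)] assms(2)] inf_le1]
      openin_imp_subset[OF chart(1)[OF assms(1)]] by blast
  then have "openin (top_of_set (\<phi> ` U)) (\<phi> ` (U \<inter> W))"
    using homeomorphism_imp_open_map[OF chart(3)[OF assms(1)]] by blast
  then show ?thesis using chart(2)[OF assms(1)] by (rule openin_open_trans)
qed

lemma open_chart_overlap:
  assumes "(U, \<phi>) \<in> A" "(V, \<psi>) \<in> A"
  shows "open (\<phi> ` (U \<inter> V))"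
  using open_chart_image[OF assms(1) chart(1)[OF assms(2)]] .

lemma holomorphic_transition:
  assumes "(U, \<phi>) \<in> A" "(V, \<psi>) \<in> A"
  shows "(\<psi> \<circ> inv_into U \<phi>) holomorphic_on \<phi> ` (U \<inter> V)"
proof -
  have "\<forall>(U, \<phi>)\<in>A. \<forall>(V, \<psi>)\<in>A. (\<psi> \<circ> inv_into U \<phi>) holomorphic_on \<phi> ` (U \<inter> V)"
    using surface unfolding riemann_surface_def by (elim conjE)
  from bspec[OF this assms(1)] have "\<forall>(V, \<psi>)\<in>A. (\<psi> \<circ> inv_into U \<phi>) holomorphic_on \<phi> ` (U \<inter> V)"
    by simp
  from bspec[OF this assms(2)] show ?thesis by simp
qed

text \<open>
  A curve given in one chart is differentiated in another one by the chain rule. The same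
  transition factor \<open>deriv (\<psi> \<circ> inv_into U \<phi>) (g t)\<close> occurs in the derivative of holomorphic disks,
  and this is why velocities of curves and derivatives of disks can be compared in all charts at
  once.
\<close>

lemma has_vector_derivative_other_chart:
  assumes U: "(U, \<phi>) \<in> A" and V: "(V, \<psi>) \<in> A"
    and \<gamma>: "\<And>s. s \<in> I \<Longrightarrow> \<gamma> s = inv_into U \<phi> (g s)"
    and g: "(g has_vector_derivative v) (at t within I)" "t \<in> I" "g t \<in> \<phi> ` (U \<inter> V)"
  shows "((\<psi> \<circ> \<gamma>) has_vector_derivative deriv (\<psi> \<circ> inv_into U \<phi>) (g t) * v) (at t within I)"
proof -
  have "((\<psi> \<circ> inv_into U \<phi>) has_field_derivative deriv (\<psi> \<circ> inv_into U \<phi>) (g t)) (at (g t))"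
    using holomorphic_derivI[OF holomorphic_transition[OF U V] open_chart_overlap[OF U V] g(3)] .
  then have "(((\<psi> \<circ> inv_into U \<phi>) \<circ> g) has_vector_derivative v * deriv (\<psi> \<circ> inv_into U \<phi>) (g t)) (at t within I)"
    by (rule field_vector_diff_chain_within[OF g(1) has_field_derivative_at_within])
  then have "(((\<psi> \<circ> inv_into U \<phi>) \<circ> g) has_vector_derivative deriv (\<psi> \<circ> inv_into U \<phi>) (g t) * v) (at t within I)"
    by (simp only: mult.commute)
  then show ?thesis
    by (rule has_vector_derivative_transform[OF g(2), rotated]) (simp add: \<gamma>)
qed

lemma C1_curve_on_from_chart:
  assumes U: "(U, \<phi>) \<in> A"
    and \<gamma>: "\<And>t. t \<in> {a..b} \<Longrightarrow> \<gamma> t = inv_into U \<phi> (g t)" "\<And>t. t \<in> {a..b} \<Longrightarrow> g t \<in> \<phi> ` U"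
    and g: "\<And>t. t \<in> {a..b} \<Longrightarrow> (g has_vector_derivative g' t) (at t within {a..b})"
    and g': "continuous_on {a..b} g'"
  shows "C1_curve_on (restrict_atlas Y A) a b \<gamma>"
  unfolding C1_curve_on_def
proof
  fix c assume "c \<in> restrict_atlas Y A"
  then obtain V \<psi> where V: "c = (V \<inter> Y, \<psi>)" "(V, \<psi>) \<in> A"
    unfolding restrict_atlas_def by auto
  let ?d = "\<lambda>t. deriv (\<psi> \<circ> inv_into U \<phi>) (g t) * g' t"
  let ?I = "{t \<in> {a..b}. \<gamma> t \<in> V \<inter> Y}"
  have in_overlap: "g t \<in> \<phi> ` (U \<inter> V)" if "t \<in> ?I" for t
  proof -
    have "g t = \<phi> (\<gamma> t)" "\<gamma> t \<in> U \<inter> V"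
      using that \<gamma>[of t] chart_inv[OF U, of "g t" U] by auto
    then show ?thesis by blast
  qed
  have "continuous_on {a..b} g"
    by (rule continuous_on_vector_derivative) (rule g)
  then have cont_g: "continuous_on ?I g"
    by (rule continuous_on_subset) auto
  have "(deriv (\<psi> \<circ> inv_into U \<phi>)) holomorphic_on \<phi> ` (U \<inter> V)"
    using holomorphic_deriv[OF holomorphic_transition[OF U V(2)] open_chart_overlap[OF U V(2)]] .
  then have "continuous_on ?I (\<lambda>t. deriv (\<psi> \<circ> inv_into U \<phi>) (g t))"
    by (rule continuous_on_compose2[OF holomorphic_on_imp_continuous_on cont_g]) (use in_overlap in blast)
  then have "continuous_on ?I ?d"
    by (intro continuous_on_mult continuous_on_subset[OF g']) auto
  moreover have "((\<psi> \<circ> \<gamma>) has_vector_derivative ?d t) (at t within {a..b})" if "t \<in> ?I" for t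
  proof (rule has_vector_derivative_other_chart[OF U V(2), where \<gamma> = \<gamma> and g = g and v = "g' t" and I = "{a..b}"])
    show "t \<in> {a..b}" using that by simp
    then show "(g has_vector_derivative g' t) (at t within {a..b})" by (rule g)
    show "g t \<in> \<phi> ` (U \<inter> V)" using that by (rule in_overlap)
  qed (rule \<gamma>(1))
  ultimately show "case c of (V, \<psi>) \<Rightarrow> \<exists>d. continuous_on {\<tau> \<in> {a..b}. \<gamma> \<tau> \<in> V} d \<and>
      (\<forall>\<tau>\<in>{a..b}. \<gamma> \<tau> \<in> V \<longrightarrow> ((\<psi> \<circ> \<gamma>) has_vector_derivative d \<tau>) (at \<tau> within {a..b}))"
    unfolding V(1) prod.case by (intro exI[of _ ?d]) blast
qed

text \<open>
  The competitor in the infimum is the straight disk \<open>\<zeta> \<mapsto> z + v * \<zeta>\<close> of radius \<open>\<rho> / K\<close> in the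
  chart. The assumption on \<open>u\<close> says that \<open>u\<close> is the tangent vector with coordinate \<open>v\<close> in \<open>\<phi>\<close>.
\<close>

lemma kobayashi_royden_le:
  assumes U: "(U, \<phi>) \<in> A" and pos: "K > 0" "\<rho> > 0"
    and disk: "ball z \<rho> \<subseteq> \<phi> ` (U \<inter> Y)" and v: "norm v \<le> K"
    and u: "\<And>\<psi>. u \<psi> = (if chart_at (restrict_atlas Y A) (inv_into U \<phi> z) \<psi>
                            then deriv (\<psi> \<circ> inv_into U \<phi>) z * v else 0)"
  shows "kobayashi_royden Y (restrict_atlas Y A) (inv_into U \<phi> z) u \<le> ennreal (2 * K / \<rho>)"
proof -
  define R where "R = \<rho> / K"
  define f where "f = (\<lambda>\<zeta>. inv_into U \<phi> (z + v * \<zeta>))"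
  have R: "R > 0" using pos by (simp add: R_def)
  have line: "z + v * \<zeta> \<in> ball z \<rho>" if "\<zeta> \<in> ball 0 R" for \<zeta>
  proof -
    have "norm (v * \<zeta>) \<le> K * norm \<zeta>" unfolding norm_mult using v by (intro mult_right_mono) auto
    also have "\<dots> < \<rho>" using that pos by (simp add: R_def field_simps)
    finally show ?thesis by (simp add: dist_norm)
  qed
  have f_in: "f \<zeta> \<in> U \<inter> Y" if "\<zeta> \<in> ball 0 R" for \<zeta>
    using chart_inv(1)[OF U, of "z + v * \<zeta>" "U \<inter> Y"] line[OF that] disk unfolding f_def by blast
  have overlap: "z + v * \<zeta> \<in> \<phi> ` (U \<inter> V)" if "\<zeta> \<in> ball 0 R" "f \<zeta> \<in> V" for \<zeta> V
  proof -
    have "z + v * \<zeta> = \<phi> (f \<zeta>)"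
      using chart_inv(2)[OF U, of "z + v * \<zeta>" "U \<inter> Y"] line[OF that(1)] disk unfolding f_def by auto
    then show ?thesis using f_in[OF that(1)] that(2) by blast
  qed
  have hol: "(\<psi> \<circ> f) holomorphic_on {\<zeta> \<in> ball 0 R. f \<zeta> \<in> V}" if V: "(V, \<psi>) \<in> A" for V \<psi>
  proof -
    have "((\<psi> \<circ> inv_into U \<phi>) \<circ> (\<lambda>\<zeta>. z + v * \<zeta>)) holomorphic_on {\<zeta> \<in> ball 0 R. f \<zeta> \<in> V}"
    proof (rule holomorphic_on_compose_gen[OF _ holomorphic_transition[OF U V]])
      show "(\<lambda>\<zeta>. z + v * \<zeta>) ` {\<zeta> \<in> ball 0 R. f \<zeta> \<in> V} \<subseteq> \<phi> ` (U \<inter> V)"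
        using overlap by blast
    qed (intro holomorphic_intros)
    then show ?thesis by (simp add: f_def comp_def)
  qed
  have "continuous_on (ball 0 R) f"
  proof -
    have "continuous_on (\<phi> ` U) (inv_into U \<phi>)" using chart(3)[OF U] by (simp add: homeomorphism_def)
    then show ?thesis unfolding f_def
    proof (rule continuous_on_compose2)
      show "(\<lambda>\<zeta>. z + v * \<zeta>) ` ball 0 R \<subseteq> \<phi> ` U" using line disk by blast
    qed (intro continuous_intros)
  qed
  then have curve: "holomorphic_curve (ball 0 R) Y (restrict_atlas Y A) f"
    unfolding holomorphic_curve_def
  proof (intro conjI ballI)
    show "f ` ball 0 R \<subseteq> Y" using f_in by blast
    fix c assume "c \<in> restrict_atlas Y A"
    then obtain V \<psi> where V: "c = (V \<inter> Y, \<psi>)" "(V, \<psi>) \<in> A"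
      unfolding restrict_atlas_def by auto
    show "case c of (V, \<psi>) \<Rightarrow> (\<psi> \<circ> f) holomorphic_on {\<zeta> \<in> ball 0 R. f \<zeta> \<in> V}"
      unfolding V(1) prod.case by (rule holomorphic_on_subset[OF hol[OF V(2)]]) auto
  qed
  have "curve_deriv (restrict_atlas Y A) f 0 = u"
  proof
    fix \<psi>
    show "curve_deriv (restrict_atlas Y A) f 0 \<psi> = u \<psi>"
    proof (cases "chart_at (restrict_atlas Y A) (f 0) \<psi>")
      case True
      then obtain V where V: "(V, \<psi>) \<in> A" "f 0 \<in> V"
        unfolding chart_at_restrict_atlas_iff by (auto simp: chart_at_def)
      have z: "z \<in> \<phi> ` (U \<inter> V)" using overlap[of 0 V] V(2) R by simp
      have "((\<psi> \<circ> inv_into U \<phi>) has_field_derivative deriv (\<psi> \<circ> inv_into U \<phi>) z) (at (z + v * 0))"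
        unfolding mult_zero_right add_0_right
        by (rule holomorphic_derivI[OF holomorphic_transition[OF U V(1)] open_chart_overlap[OF U V(1)] z])
      moreover have "((\<lambda>\<zeta>. z + v * \<zeta>) has_field_derivative v) (at 0)"
        by (auto intro!: derivative_eq_intros)
      ultimately have "((\<psi> \<circ> inv_into U \<phi>) \<circ> (\<lambda>\<zeta>. z + v * \<zeta>) has_field_derivative
          deriv (\<psi> \<circ> inv_into U \<phi>) z * v) (at 0)"
        by (rule DERIV_chain)
      then have "deriv (\<psi> \<circ> f) 0 = deriv (\<psi> \<circ> inv_into U \<phi>) z * v"
        unfolding f_def comp_def by (rule DERIV_imp_deriv)
      then show ?thesis using True by (simp add: curve_deriv_def u f_def)
    qed (simp add: curve_deriv_def u f_def)
  qed
  then have "kobayashi_royden Y (restrict_atlas Y A) (inv_into U \<phi> z) u \<le> ennreal (2 / R)"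
    unfolding kobayashi_royden_def
    by (intro Inf_lower CollectI exI[of _ R] exI[of _ f] conjI refl R curve) (auto simp: f_def)
  then show ?thesis by (simp add: R_def)
qed

end


section \<open>Average length of a family of curves in one chart\<close>

lemma norm_diff_le_of_vector_derivative:
  fixes f :: "real \<Rightarrow> complex"
  assumes "\<And>t. t \<in> {a..b} \<Longrightarrow> (f has_vector_derivative f' t) (at t within {a..b})"
    and "\<And>t. t \<in> {a..b} \<Longrightarrow> norm (f' t) \<le> K"
    and "s \<in> {a..b}" "t \<in> {a..b}"
  shows "norm (f s - f t) \<le> K * \<bar>s - t\<bar>"
proof -
  have "norm (f s - f t) \<le> K * norm (s - t)"
  proof (rule differentiable_bound[where S = "{a..b}" and f' = "\<lambda>t h. h *\<^sub>R f' t"])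
    show "onorm (\<lambda>h. h *\<^sub>R f' x) \<le> K" if "x \<in> {a..b}" for x
    proof (rule onorm_bound)
      show "0 \<le> K" using order_trans[OF norm_ge_zero assms(2)[OF that]] .
      show "norm (h *\<^sub>R f' x) \<le> K * norm h" for h
        using mult_right_mono[OF assms(2)[OF that], of "norm h"] by (simp add: mult.commute)
    qed
  qed (use assms in \<open>auto simp: has_vector_derivative_def\<close>)
  then show ?thesis by simp
qed

lemma continuous_on_slice:
  assumes "continuous_on (X \<times> Y) (\<lambda>(x, y). f x y)"
  shows "y \<in> Y \<Longrightarrow> continuous_on X (\<lambda>x. f x y)" "x \<in> X \<Longrightarrow> continuous_on Y (\<lambda>y. f x y)"
proof -
  assume "y \<in> Y"
  then have "continuous_on X (\<lambda>x. case (x, y) of (x, y) \<Rightarrow> f x y)"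
    by (intro continuous_on_compose2[OF assms]) (auto intro!: continuous_intros)
  then show "continuous_on X (\<lambda>x. f x y)" by simp
next
  assume "x \<in> X"
  then have "continuous_on Y (\<lambda>y. case (x, y) of (x, y) \<Rightarrow> f x y)"
    by (intro continuous_on_compose2[OF assms]) (auto intro!: continuous_intros)
  then show "continuous_on Y (\<lambda>y. f x y)" by simp
qed

text \<open>
  The balance behind the exponent \<open>1/2\<close>: the constant \<open>1 / r = sqrt (s + 1)\<close> bounds the metric away
  from the punctures, and near the punctures there are at most \<open>s\<close> terms of order
  \<open>r = 1 / sqrt (s + 1)\<close> each.
\<close>

lemma nn_integral_sum_dyadic_reciprocal_le:
  fixes g :: "complex \<Rightarrow> complex"
  assumes pos: "c > 0" "d > 0" "K > 0" "\<delta> > 0"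
    and g: "continuous_on (cball 0 \<delta>) g"
    and expand: "\<And>w w'. w \<in> cball 0 \<delta> \<Longrightarrow> w' \<in> cball 0 \<delta> \<Longrightarrow> c * norm (w - w') \<le> norm (g w - g w')"
    and T: "finite T" "card T \<le> s" and r: "r = 1 / sqrt (real (s + 1))"
  shows "(\<integral>\<^sup>+ w\<in>cball 0 \<delta>. (ennreal (2 * K) *
             (ennreal (1 / d + 1 / r) + (\<Sum>q\<in>T. dyadic_reciprocal r (g w - q)))) \<partial>lborel)
         \<le> ennreal (2 * K * ((1 / d + 1) * (pi * \<delta>\<^sup>2) + 16 * pi / c\<^sup>2) * sqrt (real (s + 1)))"
proof -
  let ?D = "cball (0::complex) \<delta>" and ?N = "sqrt (real (s + 1))"
  have r_pos: "r > 0" and r_inv: "1 / r = ?N" by (simp_all add: r)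
  define h where "h w = g w * indicator ?D w" for w
  have h_m [measurable]: "h \<in> borel_measurable borel"
    using borel_measurable_continuous_on_indicator[OF _ g]
    by (rule back_subst[where P = "\<lambda>h. h \<in> borel_measurable borel"]) (auto simp: indicator_def h_def)
  have D_m [measurable]: "?D \<in> sets borel" by simp
  have each: "(\<integral>\<^sup>+ w. dyadic_reciprocal r (h w - q) * indicator ?D w \<partial>lborel) \<le> ennreal (16 * pi * r / c\<^sup>2)" for q
  proof -
    have "(\<integral>\<^sup>+ w. dyadic_reciprocal r (h w - q) * indicator ?D w \<partial>lborel)
        = (\<integral>\<^sup>+ w. dyadic_reciprocal r (g w - q) * indicator ?D w \<partial>lborel)"
      by (intro nn_integral_cong) (auto simp: h_def indicator_def)
    also have "\<dots> \<le> ennreal (16 * pi * r / c\<^sup>2)"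
      by (rule nn_integral_dyadic_reciprocal_le[OF pos(1) r_pos g expand])
    finally show ?thesis .
  qed
  have "(\<Sum>q\<in>T. \<integral>\<^sup>+ w. dyadic_reciprocal r (h w - q) * indicator ?D w \<partial>lborel)
      \<le> (\<Sum>q\<in>T. ennreal (16 * pi * r / c\<^sup>2))"
    by (intro sum_mono each)
  also have "\<dots> = ennreal (real (card T) * (16 * pi * r / c\<^sup>2))"
    using r_pos unfolding sum_constant ennreal_of_nat_eq_real_of_nat
    by (intro ennreal_mult[symmetric]) auto
  also have "\<dots> \<le> ennreal (?N * (16 * pi / c\<^sup>2))"
  proof (rule ennreal_leI)
    have "real (card T) * r \<le> real (s + 1) * r"
      using T(2) r_pos by (intro mult_right_mono) auto
    also have "\<dots> = ?N" by (simp add: r real_div_sqrt)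
    finally have "real (card T) * r * (16 * pi / c\<^sup>2) \<le> ?N * (16 * pi / c\<^sup>2)"
      by (intro mult_right_mono) auto
    then show "real (card T) * (16 * pi * r / c\<^sup>2) \<le> ?N * (16 * pi / c\<^sup>2)"
      by (simp add: algebra_simps)
  qed
  finally have near: "(\<Sum>q\<in>T. \<integral>\<^sup>+ w. dyadic_reciprocal r (h w - q) * indicator ?D w \<partial>lborel)
      \<le> ennreal (?N * (16 * pi / c\<^sup>2))" .
  have "ennreal (1 / d + 1 / r) * emeasure lborel ?D = ennreal ((1 / d + 1 / r) * (pi * \<delta>\<^sup>2))"
    using pos r_pos by (simp add: emeasure_cball unit_ball_vol_2 ennreal_mult)
  also have "\<dots> \<le> ennreal ((1 / d + 1) * ?N * (pi * \<delta>\<^sup>2))"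
  proof (intro ennreal_leI mult_right_mono)
    have "1 / d * 1 \<le> 1 / d * ?N" using pos by (intro mult_left_mono) auto
    then show "1 / d + 1 / r \<le> (1 / d + 1) * ?N" unfolding r_inv by (simp add: algebra_simps)
  qed simp
  finally have far: "ennreal (1 / d + 1 / r) * emeasure lborel ?D \<le> ennreal ((1 / d + 1) * ?N * (pi * \<delta>\<^sup>2))" .
  have "(\<integral>\<^sup>+ w\<in>?D. (ennreal (2 * K) *
             (ennreal (1 / d + 1 / r) + (\<Sum>q\<in>T. dyadic_reciprocal r (g w - q)))) \<partial>lborel)
     = (\<integral>\<^sup>+ w. ennreal (2 * K) * (ennreal (1 / d + 1 / r) * indicator ?D w
          + (\<Sum>q\<in>T. dyadic_reciprocal r (h w - q) * indicator ?D w)) \<partial>lborel)"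
    by (intro nn_integral_cong) (auto simp: h_def indicator_def)
  also have "\<dots> = ennreal (2 * K) * (\<integral>\<^sup>+ w. ennreal (1 / d + 1 / r) * indicator ?D w
          + (\<Sum>q\<in>T. dyadic_reciprocal r (h w - q) * indicator ?D w) \<partial>lborel)"
    by (rule nn_integral_cmult) measurable
  also have "(\<integral>\<^sup>+ w. ennreal (1 / d + 1 / r) * indicator ?D w
          + (\<Sum>q\<in>T. dyadic_reciprocal r (h w - q) * indicator ?D w) \<partial>lborel)
      = (\<integral>\<^sup>+ w. ennreal (1 / d + 1 / r) * indicator ?D w \<partial>lborel)
        + (\<integral>\<^sup>+ w. (\<Sum>q\<in>T. dyadic_reciprocal r (h w - q) * indicator ?D w) \<partial>lborel)"
    by (rule nn_integral_add) measurable
  also have "(\<integral>\<^sup>+ w. (\<Sum>q\<in>T. dyadic_reciprocal r (h w - q) * indicator ?D w) \<partial>lborel)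
      = (\<Sum>q\<in>T. \<integral>\<^sup>+ w. dyadic_reciprocal r (h w - q) * indicator ?D w \<partial>lborel)"
    by (rule nn_integral_sum) measurable
  also have "(\<integral>\<^sup>+ w. ennreal (1 / d + 1 / r) * indicator ?D w \<partial>lborel)
      = ennreal (1 / d + 1 / r) * emeasure lborel ?D"
    by (rule nn_integral_cmult_indicator) simp
  also have "ennreal (2 * K) * (ennreal (1 / d + 1 / r) * emeasure lborel ?D
       + (\<Sum>q\<in>T. \<integral>\<^sup>+ w. dyadic_reciprocal r (h w - q) * indicator ?D w \<partial>lborel))
     \<le> ennreal (2 * K) * (ennreal ((1 / d + 1) * ?N * (pi * \<delta>\<^sup>2)) + ennreal (?N * (16 * pi / c\<^sup>2)))"
    by (intro mult_left_mono add_mono near far) simp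
  also have "\<dots> = ennreal (2 * K * ((1 / d + 1) * ?N * (pi * \<delta>\<^sup>2) + ?N * (16 * pi / c\<^sup>2)))"
    using pos by (subst ennreal_plus[symmetric], simp_all del: ennreal_plus add: ennreal_mult[symmetric])
  also have "2 * K * ((1 / d + 1) * ?N * (pi * \<delta>\<^sup>2) + ?N * (16 * pi / c\<^sup>2))
     = 2 * K * ((1 / d + 1) * (pi * \<delta>\<^sup>2) + 16 * pi / c\<^sup>2) * ?N"
    by (simp add: algebra_simps)
  finally show ?thesis .
qed

context open_part_of_surface
begin

text \<open>
  The integrand of the length is not known to be measurable, so lengths of consecutive arcs cannot
  simply be added. For this reason the bound \<open>L\<close> is witnessed by a measurable majorant \<open>h\<close>. An
  almost everywhere bound suffices and leaves out the break points, where the velocity of a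
  piecewise differentiable curve has no meaning.
\<close>

definition admissible_arc :: "'a set \<Rightarrow> real \<Rightarrow> real \<Rightarrow> (real \<Rightarrow> 'a) \<Rightarrow> ennreal \<Rightarrow> bool" where
  "admissible_arc S a b \<gamma> L \<longleftrightarrow>
     \<gamma> ` {a..b} \<subseteq> B\<^sub>0 - S \<and>
     (\<exists>n (p :: nat \<Rightarrow> real). p 0 = a \<and> p n = b \<and>
        (\<forall>i<n. p i < p (Suc i) \<and> C1_curve_on (restrict_atlas (B\<^sub>0 - S) A) (p i) (p (Suc i)) \<gamma>)) \<and>
     (\<exists>h. h \<in> borel_measurable borel \<and>
        (AE t in lborel. t \<in> {a..b} \<longrightarrow>
           kobayashi_royden (B\<^sub>0 - S) (restrict_atlas (B\<^sub>0 - S) A) (\<gamma> t)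
             (velocity (restrict_atlas (B\<^sub>0 - S) A) \<gamma> t) \<le> h t) \<and>
        (\<integral>\<^sup>+ t\<in>{a..b}. h t \<partial>lborel) \<le> L)"

text \<open>
  A piece of the family that lies in one chart: \<open>g\<close> is its coordinate expression and \<open>g'\<close> the
  velocity. The last clause is the expansion property that controls the averages over \<open>w\<close>.
\<close>

definition chart_sweep :: "real \<Rightarrow> (complex \<Rightarrow> real \<Rightarrow> 'a) \<Rightarrow> real \<Rightarrow> real \<Rightarrow> bool" where
  "chart_sweep \<delta> \<Gamma> a b \<longleftrightarrow> (\<exists>U \<phi> g g' c. (U, \<phi>) \<in> A \<and> c > 0 \<and>
     continuous_on (cball 0 \<delta> \<times> {a..b}) (\<lambda>(w, t). g w t) \<and>
     continuous_on (cball 0 \<delta> \<times> {a..b}) (\<lambda>(w, t). g' w t) \<and>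
     (\<forall>w\<in>cball 0 \<delta>. \<forall>t\<in>{a..b}. \<Gamma> w t = inv_into U \<phi> (g w t) \<and> g w t \<in> \<phi> ` (U \<inter> B\<^sub>0) \<and>
        (g w has_vector_derivative g' w t) (at t within {a..b})) \<and>
     (\<forall>t\<in>{a..b}. \<forall>w\<in>cball 0 \<delta>. \<forall>w'\<in>cball 0 \<delta>. c * norm (w - w') \<le> norm (g w t - g w' t)))"

text \<open>
  Members of the family that pass through \<open>S\<close> are not excluded; for them \<open>\<Phi> w\<close> is \<open>\<infinity>\<close>. The
  constant \<open>C\<close> is chosen before \<open>S\<close> and \<open>s\<close>.
\<close>

definition short_on_average :: "real \<Rightarrow> (complex \<Rightarrow> real \<Rightarrow> 'a) \<Rightarrow> real \<Rightarrow> real \<Rightarrow> bool" where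
  "short_on_average \<delta> \<Gamma> a b \<longleftrightarrow> (\<exists>C\<ge>0. \<forall>S s. finite S \<and> S \<subseteq> B\<^sub>0 \<and> card S \<le> s \<longrightarrow>
     (\<exists>\<Phi>. \<Phi> \<in> borel_measurable borel \<and>
        (\<integral>\<^sup>+ w\<in>cball 0 \<delta>. \<Phi> w \<partial>lborel) \<le> ennreal (C * sqrt (real (s + 1))) \<and>
        (\<forall>w\<in>cball 0 \<delta>. \<Phi> w < top \<longrightarrow> admissible_arc S a b (\<Gamma> w) (\<Phi> w))))"

text \<open>
  The largest disk around \<open>z\<close> that is known to avoid \<open>S\<close> has radius \<open>d\<close> or reaches up to the nearest
  puncture. In the latter case either the puncture is closer than \<open>r\<close> and its majorant is one of
  the summands, or \<open>1 / r\<close> is already large enough.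
\<close>

lemma kobayashi_royden_punctured_le:
  assumes U: "(U, \<phi>) \<in> A" and pos: "K > 0" "d > 0" "r > 0" and fin: "finite T"
    and T: "T = \<phi> ` (S \<inter> U)" and z: "z \<notin> T"
    and disk: "ball z d \<subseteq> \<phi> ` (U \<inter> B\<^sub>0)" and v: "norm v \<le> K"
    and u: "\<And>\<psi>. u \<psi> = (if chart_at (restrict_atlas (B\<^sub>0 - S) A) (inv_into U \<phi> z) \<psi>
                            then deriv (\<psi> \<circ> inv_into U \<phi>) z * v else 0)"
  shows "kobayashi_royden (B\<^sub>0 - S) (restrict_atlas (B\<^sub>0 - S) A) (inv_into U \<phi> z) u
           \<le> ennreal (2 * K) * (ennreal (1 / d + 1 / r) + (\<Sum>q\<in>T. dyadic_reciprocal r (z - q)))"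
proof -
  define \<rho> where "\<rho> = Min (insert d ((\<lambda>q. norm (z - q)) ` T))"
  have \<rho>_pos: "\<rho> > 0" using pos(2) fin z by (subst \<rho>_def, subst Min_gr_iff) auto
  have \<rho>_le: "\<rho> \<le> d" "\<And>q. q \<in> T \<Longrightarrow> \<rho> \<le> norm (z - q)"
    using fin by (auto simp: \<rho>_def intro!: Min_le)
  have "ball z \<rho> \<subseteq> \<phi> ` (U \<inter> (B\<^sub>0 - S))"
  proof
    fix y assume y: "y \<in> ball z \<rho>"
    then have "y \<in> ball z d" using \<rho>_le(1) by auto
    then obtain x where x: "x \<in> U" "x \<in> B\<^sub>0" "y = \<phi> x" using disk by blast
    have "x \<notin> S"
    proof
      assume "x \<in> S"
      then have "y \<in> T" using x T by blast
      then show False using \<rho>_le(2)[of y] y by (auto simp: dist_norm)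
    qed
    then show "y \<in> \<phi> ` (U \<inter> (B\<^sub>0 - S))" using x by blast
  qed
  then have "kobayashi_royden (B\<^sub>0 - S) (restrict_atlas (B\<^sub>0 - S) A) (inv_into U \<phi> z) u
      \<le> ennreal (2 * K / \<rho>)"
    using kobayashi_royden_le[OF U pos(1) \<rho>_pos _ v u] by blast
  also have "\<dots> = ennreal (2 * K) * ennreal (1 / \<rho>)"
    using pos \<rho>_pos by (simp add: ennreal_mult[symmetric])
  also have "ennreal (1 / \<rho>) \<le> ennreal (1 / d + 1 / r) + (\<Sum>q\<in>T. dyadic_reciprocal r (z - q))"
  proof (cases "1 / \<rho> \<le> 1 / d + 1 / r")
    case True
    then show ?thesis by (rule add_increasing2[OF zero_le ennreal_leI])
  next
    case False
    have "1 / d > 0" "1 / r > 0" using pos by auto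
    then have "\<rho> \<noteq> d" using False by auto
    moreover have "\<rho> \<in> insert d ((\<lambda>q. norm (z - q)) ` T)"
      unfolding \<rho>_def using fin by (intro Min_in) auto
    ultimately obtain q where q: "q \<in> T" "\<rho> = norm (z - q)" by auto
    have "\<not> 1 / \<rho> \<le> 1 / r" using False \<open>1 / d > 0\<close> by linarith
    then have "\<rho> < r" using \<rho>_pos pos(3) by (simp add: field_simps)
    then have "ennreal (1 / \<rho>) \<le> dyadic_reciprocal r (z - q)"
      using reciprocal_le_dyadic_reciprocal[of "z - q" r] q \<rho>_pos by auto
    also have "\<dots> \<le> (\<Sum>q\<in>T. dyadic_reciprocal r (z - q))"
      using sum_mono2[OF fin, of "{q}" "\<lambda>q. dyadic_reciprocal r (z - q)"] q(1) by simp
    finally show ?thesis by (rule add_increasing[OF zero_le])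
  qed
  finally show ?thesis by (simp add: mult_left_mono)
qed

text \<open>
  The bound \<open>\<Phi> w\<close> for the length of the curve \<open>\<Gamma> w\<close> is the integral over \<open>t\<close> of the pointwise
  bound for the metric; by Tonelli's theorem its average over \<open>w\<close> is computed for each \<open>t\<close>
  separately. Finiteness of \<open>\<Phi> w\<close> forces the curve to avoid the punctures.
\<close>

lemma short_on_average_chart_sweep:
  assumes sweep: "chart_sweep \<delta> \<Gamma> a b" and \<delta>: "\<delta> > 0" and ab: "a < b" "0 \<le> a" "b \<le> 1"
  shows "short_on_average \<delta> \<Gamma> a b"
proof -
  obtain U \<phi> g g' c where U: "(U, \<phi>) \<in> A" and c: "c > 0"
    and g: "continuous_on (cball 0 \<delta> \<times> {a..b}) (\<lambda>(w, t). g w t)"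
    and g': "continuous_on (cball 0 \<delta> \<times> {a..b}) (\<lambda>(w, t). g' w t)"
    and \<Gamma>: "\<And>w t. w \<in> cball 0 \<delta> \<Longrightarrow> t \<in> {a..b} \<Longrightarrow> \<Gamma> w t = inv_into U \<phi> (g w t)"
    and g_in: "\<And>w t. w \<in> cball 0 \<delta> \<Longrightarrow> t \<in> {a..b} \<Longrightarrow> g w t \<in> \<phi> ` (U \<inter> B\<^sub>0)"
    and der: "\<And>w t. w \<in> cball 0 \<delta> \<Longrightarrow> t \<in> {a..b} \<Longrightarrow>
                (g w has_vector_derivative g' w t) (at t within {a..b})"
    and expand: "\<And>t w w'. t \<in> {a..b} \<Longrightarrow> w \<in> cball 0 \<delta> \<Longrightarrow> w' \<in> cball 0 \<delta> \<Longrightarrow>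
                c * norm (w - w') \<le> norm (g w t - g w' t)"
    using sweep unfolding chart_sweep_def by blast
  let ?X = "cball 0 \<delta> \<times> {a..b} :: (complex \<times> real) set"
  have X: "compact ?X" by (intro compact_Times) auto
  obtain K where K: "K > 0" "\<And>w t. w \<in> cball 0 \<delta> \<Longrightarrow> t \<in> {a..b} \<Longrightarrow> norm (g' w t) \<le> K"
  proof -
    have "bounded ((\<lambda>(w, t). g' w t) ` ?X)"
      by (intro compact_imp_bounded compact_continuous_image g' X)
    then obtain K where "K > 0" "\<forall>x\<in>(\<lambda>(w, t). g' w t) ` ?X. norm x \<le> K"
      unfolding bounded_pos by blast
    then show thesis by (intro that[of K]) auto
  qed
  obtain d where d: "d > 0" "\<And>w t. w \<in> cball 0 \<delta> \<Longrightarrow> t \<in> {a..b} \<Longrightarrow> ball (g w t) d \<subseteq> \<phi> ` (U \<inter> B\<^sub>0)"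
  proof -
    have "compact ((\<lambda>(w, t). g w t) ` ?X)"
      by (intro compact_continuous_image g X)
    moreover have "(\<lambda>(w, t). g w t) ` ?X \<subseteq> \<phi> ` (U \<inter> B\<^sub>0)"
      using g_in by (intro image_subsetI) (simp add: split_beta mem_Times_iff)
    ultimately obtain d where d: "d > 0" "(\<Union>x\<in>(\<lambda>(w, t). g w t) ` ?X. ball x d) \<subseteq> \<phi> ` (U \<inter> B\<^sub>0)"
      using compact_subset_open_imp_ball_epsilon_subset[OF _ open_chart_image[OF U open_part]] by blast
    show thesis
    proof (rule that[OF d(1)])
      fix w t assume "w \<in> cball (0::complex) \<delta>" "t \<in> {a..b}"
      then have "g w t \<in> (\<lambda>(w, t). g w t) ` ?X" by (intro image_eqI[of _ _ "(w, t)"]) auto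
      then show "ball (g w t) d \<subseteq> \<phi> ` (U \<inter> B\<^sub>0)" using d(2) by blast
    qed
  qed
  define C where "C = 2 * K * ((1 / d + 1) * (pi * \<delta>\<^sup>2) + 16 * pi / c\<^sup>2)"
  have C: "C \<ge> 0" using K d \<delta> by (simp add: C_def)
  have C_ab: "(b - a) * C \<ge> 0" using C ab by simp
  show ?thesis unfolding short_on_average_def
  proof (intro exI[of _ "(b - a) * C"] conjI C_ab allI impI)
    fix S :: "'a set" and s :: nat
    assume S: "finite S \<and> S \<subseteq> B\<^sub>0 \<and> card S \<le> s"
    define r where "r = 1 / sqrt (real (s + 1))"
    have r: "r > 0" "1 / r = sqrt (real (s + 1))" by (auto simp: r_def)
    define T where "T = \<phi> ` (S \<inter> U)"
    have T: "finite T" "card T \<le> s"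
      using S card_image_le[of "S \<inter> U" \<phi>] card_mono[of S "S \<inter> U"] by (auto simp: T_def)
    \<comment> \<open>Extended by \<open>0\<close> outside of \<open>?X\<close>, the coordinate \<open>g\<close> becomes Borel measurable.\<close>
    define gX where "gX x = indicator ?X x *\<^sub>R (case x of (w, t) \<Rightarrow> g w t)" for x
    have gX_m [measurable]: "gX \<in> borel_measurable (borel \<Otimes>\<^sub>M borel)"
      unfolding gX_def borel_prod
      by (rule borel_measurable_continuous_on_indicator[OF _ g]) (intro borel_closed closed_Times; simp)
    define F where "F x = indicator ?X x * (ennreal (2 * K) *
        (ennreal (1 / d + 1 / r) + (\<Sum>q\<in>T. dyadic_reciprocal r (gX x - q))))" for x
    have X_m: "?X \<in> sets (borel \<Otimes>\<^sub>M borel)"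
      unfolding borel_prod by (intro borel_closed closed_Times) auto
    have F_m [measurable]: "F \<in> borel_measurable (borel \<Otimes>\<^sub>M borel)"
      unfolding F_def by (intro borel_measurable_times_ennreal borel_measurable_indicator X_m
        borel_measurable_const borel_measurable_add borel_measurable_sum
        measurable_compose[OF _ measurable_dyadic_reciprocal] borel_measurable_diff gX_m)
    have F_m' : "F \<in> borel_measurable (lborel \<Otimes>\<^sub>M lborel)"
      using F_m by (simp cong: measurable_cong_sets sets_pair_measure_cong)
    have F_eq: "F (w, t) = ennreal (2 * K) *
        (ennreal (1 / d + 1 / r) + (\<Sum>q\<in>T. dyadic_reciprocal r (g w t - q)))"
      if "w \<in> cball 0 \<delta>" "t \<in> {a..b}" for w t
      using that by (simp add: F_def gX_def)
    define \<Phi> where "\<Phi> w = (\<integral>\<^sup>+ t. F (w, t) \<partial>lborel)" for w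
    have \<Phi>_m: "\<Phi> \<in> borel_measurable borel"
      using lborel.borel_measurable_nn_integral_fst[OF F_m'] by (simp add: \<Phi>_def[abs_def])
    have slice: "(\<integral>\<^sup>+ w. F (w, t) \<partial>lborel) \<le> ennreal (C * sqrt (real (s + 1))) * indicator {a..b} t" for t
    proof (cases "t \<in> {a..b}")
      case True
      have "(\<integral>\<^sup>+ w. F (w, t) \<partial>lborel)
         = (\<integral>\<^sup>+ w\<in>cball 0 \<delta>. (ennreal (2 * K) *
             (ennreal (1 / d + 1 / r) + (\<Sum>q\<in>T. dyadic_reciprocal r (g w t - q)))) \<partial>lborel)"
        using True by (intro nn_integral_cong) (auto simp: F_def gX_def indicator_def)
      also have "\<dots> \<le> ennreal (C * sqrt (real (s + 1)))"
        unfolding C_def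
        by (rule nn_integral_sum_dyadic_reciprocal_le[OF c d(1) K(1) \<delta> continuous_on_slice(1)[OF g True]
              expand[OF True] T r_def])
      finally show ?thesis using True by simp
    qed (simp add: F_def)
    have "(\<integral>\<^sup>+ w\<in>cball 0 \<delta>. \<Phi> w \<partial>lborel) \<le> (\<integral>\<^sup>+ w. \<Phi> w \<partial>lborel)"
      by (intro nn_integral_mono) (auto simp: indicator_def)
    also have "\<dots> = (\<integral>\<^sup>+ t. (\<integral>\<^sup>+ w. F (w, t) \<partial>lborel) \<partial>lborel)"
      unfolding \<Phi>_def by (rule lborel_pair.Fubini[OF F_m', symmetric])
    also have "\<dots> \<le> (\<integral>\<^sup>+ t. ennreal (C * sqrt (real (s + 1))) * indicator {a..b} t \<partial>lborel)"
      by (intro nn_integral_mono slice)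
    also have "\<dots> = ennreal ((b - a) * C * sqrt (real (s + 1)))"
      using ab C by (subst nn_integral_cmult_indicator) (simp_all add: ennreal_mult[symmetric] mult_ac)
    finally have \<Phi>_int: "(\<integral>\<^sup>+ w\<in>cball 0 \<delta>. \<Phi> w \<partial>lborel) \<le> ennreal ((b - a) * C * sqrt (real (s + 1)))" .
    have arc: "admissible_arc S a b (\<Gamma> w) (\<Phi> w)" if w: "w \<in> cball 0 \<delta>" and fin: "\<Phi> w < top" for w
    proof -
      have \<Phi>_eq: "\<Phi> w = (\<integral>\<^sup>+ t\<in>{a..b}. F (w, t) \<partial>lborel)"
        unfolding \<Phi>_def by (intro nn_integral_cong) (auto simp: F_def indicator_def)
      have avoid_T: "g w t0 \<notin> T" if t0: "t0 \<in> {a..b}" for t0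
      proof
        assume q: "g w t0 \<in> T"
        have "(\<integral>\<^sup>+ t. dyadic_reciprocal r (g w t - g w t0) * indicator {a..b} t \<partial>lborel) = top"
          using norm_diff_le_of_vector_derivative[OF der[OF w] K(2)[OF w]]
          by (intro nn_integral_dyadic_reciprocal_eq_top[OF K(1) r(1) ab(1) _ t0]) auto
        then have "top = ennreal (2 * K) * (\<integral>\<^sup>+ t. dyadic_reciprocal r (gX (w, t) - g w t0) * indicator {a..b} t \<partial>lborel)"
          using K(1) w by (subst nn_integral_cong[where v = "\<lambda>t. dyadic_reciprocal r (g w t - g w t0) * indicator {a..b} t"])
            (auto simp: gX_def indicator_def ennreal_mult_top)
        also have "\<dots> = (\<integral>\<^sup>+ t. ennreal (2 * K) * (dyadic_reciprocal r (gX (w, t) - g w t0) * indicator {a..b} t) \<partial>lborel)"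
          by (rule nn_integral_cmult[symmetric]) measurable
        also have "\<dots> \<le> \<Phi> w" unfolding \<Phi>_def
        proof (intro nn_integral_mono)
          fix t
          have "dyadic_reciprocal r (gX (w, t) - g w t0) \<le> (\<Sum>q\<in>T. dyadic_reciprocal r (gX (w, t) - q))"
            using sum_mono2[OF T(1), of "{g w t0}" "\<lambda>q. dyadic_reciprocal r (gX (w, t) - q)"] q by simp
          then show "ennreal (2 * K) * (dyadic_reciprocal r (gX (w, t) - g w t0) * indicator {a..b} t) \<le> F (w, t)"
            using w by (auto simp: F_def indicator_def intro!: mult_left_mono add_increasing)
        qed
        finally show False using fin by (simp add: top_unique)
      qed
      have in_B0: "\<Gamma> w t \<in> U \<inter> B\<^sub>0" "\<phi> (\<Gamma> w t) = g w t" if "t \<in> {a..b}" for t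
        unfolding \<Gamma>[OF w that] by (rule chart_inv[OF U g_in[OF w that] Int_lower1])+
      have "\<Gamma> w ` {a..b} \<subseteq> B\<^sub>0 - S"
      proof (rule image_subsetI)
        fix t assume t: "t \<in> {a..b}"
        have "\<Gamma> w t \<notin> S"
        proof
          assume "\<Gamma> w t \<in> S"
          then have "\<phi> (\<Gamma> w t) \<in> T" unfolding T_def using in_B0(1)[OF t] by blast
          then show False using avoid_T[OF t] in_B0(2)[OF t] by simp
        qed
        then show "\<Gamma> w t \<in> B\<^sub>0 - S" using in_B0(1)[OF t] by blast
      qed
      moreover have "C1_curve_on (restrict_atlas (B\<^sub>0 - S) A) a b (\<Gamma> w)"
      proof (rule C1_curve_on_from_chart[OF U \<Gamma>[OF w] _ der[OF w] continuous_on_slice(2)[OF g' w]])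
        show "g w t \<in> \<phi> ` U" if "t \<in> {a..b}" for t using g_in[OF w that] by blast
      qed
      then have "\<exists>n (p :: nat \<Rightarrow> real). p 0 = a \<and> p n = b \<and>
        (\<forall>i<n. p i < p (Suc i) \<and> C1_curve_on (restrict_atlas (B\<^sub>0 - S) A) (p i) (p (Suc i)) (\<Gamma> w))"
        using ab by (intro exI[of _ 1] exI[of _ "\<lambda>i. if i = 0 then a else b"]) auto
      moreover have pointwise: "kobayashi_royden (B\<^sub>0 - S) (restrict_atlas (B\<^sub>0 - S) A) (\<Gamma> w t)
             (velocity (restrict_atlas (B\<^sub>0 - S) A) (\<Gamma> w) t) \<le> F (w, t)" if t: "a < t" "t < b" for t
      proof -
        have t': "t \<in> {a..b}" using t by simp
        have "velocity (restrict_atlas (B\<^sub>0 - S) A) (\<Gamma> w) t \<psi> =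
            (if chart_at (restrict_atlas (B\<^sub>0 - S) A) (inv_into U \<phi> (g w t)) \<psi>
             then deriv (\<psi> \<circ> inv_into U \<phi>) (g w t) * g' w t else 0)" for \<psi>
        proof (cases "chart_at (restrict_atlas (B\<^sub>0 - S) A) (inv_into U \<phi> (g w t)) \<psi>")
          case True
          then have "\<exists>V. (V, \<psi>) \<in> A \<and> \<Gamma> w t \<in> V"
            unfolding chart_at_restrict_atlas_iff \<Gamma>[OF w t'] by (simp add: chart_at_def)
          then obtain V where V: "(V, \<psi>) \<in> A" "\<Gamma> w t \<in> V" by blast
          have "\<phi> (\<Gamma> w t) \<in> \<phi> ` (U \<inter> V)" using in_B0(1)[OF t'] V(2) by blast
          then have overlap: "g w t \<in> \<phi> ` (U \<inter> V)" unfolding in_B0(2)[OF t'] .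
          have "(\<psi> \<circ> \<Gamma> w has_vector_derivative deriv (\<psi> \<circ> inv_into U \<phi>) (g w t) * g' w t)
              (at t within {a..b})"
          proof (rule has_vector_derivative_other_chart[OF U V(1)])
            show "\<Gamma> w s = inv_into U \<phi> (g w s)" if "s \<in> {a..b}" for s by (rule \<Gamma>[OF w that])
          qed (fact der[OF w t'] t' overlap)+
          then have "(\<psi> \<circ> \<Gamma> w has_vector_derivative deriv (\<psi> \<circ> inv_into U \<phi>) (g w t) * g' w t) (at t)"
            unfolding at_within_Icc_at[OF t] .
          then show ?thesis
            using True \<Gamma>[OF w t'] t ab by (simp add: velocity_def vector_derivative_at_within_ivl)
        qed (use \<Gamma>[OF w t'] in \<open>simp add: velocity_def\<close>)
        then show ?thesis
          unfolding F_eq[OF w t'] \<Gamma>[OF w t']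
          by (intro kobayashi_royden_punctured_le[OF U K(1) d(1) r(1) T(1) T_def avoid_T[OF t'] d(2)[OF w t'] K(2)[OF w t']])
      qed
      have "AE t in lborel. t \<in> {a..b} \<longrightarrow>
           kobayashi_royden (B\<^sub>0 - S) (restrict_atlas (B\<^sub>0 - S) A) (\<Gamma> w t)
             (velocity (restrict_atlas (B\<^sub>0 - S) A) (\<Gamma> w) t) \<le> F (w, t)"
        using AE_lborel_singleton[of a] AE_lborel_singleton[of b]
        by eventually_elim (auto intro!: pointwise simp: less_le)
      ultimately show ?thesis unfolding admissible_arc_def \<Phi>_eq
        by (intro conjI exI[of _ "\<lambda>t. F (w, t)"]) auto
    qed
    show "\<exists>\<Phi>. \<Phi> \<in> borel_measurable borel \<and>
        (\<integral>\<^sup>+ w\<in>cball 0 \<delta>. \<Phi> w \<partial>lborel) \<le> ennreal ((b - a) * C * sqrt (real (s + 1))) \<and>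
        (\<forall>w\<in>cball 0 \<delta>. \<Phi> w < top \<longrightarrow> admissible_arc S a b (\<Gamma> w) (\<Phi> w))"
      using \<Phi>_m \<Phi>_int arc by blast
  qed
qed

end


section \<open>Families of curves composed of several pieces\<close>

context open_part_of_surface
begin

inductive swept :: "real \<Rightarrow> (complex \<Rightarrow> real \<Rightarrow> 'a) \<Rightarrow> real \<Rightarrow> real \<Rightarrow> bool" for \<delta> \<Gamma> where
  piece: "a < b \<Longrightarrow> chart_sweep \<delta> \<Gamma> a b \<Longrightarrow> swept \<delta> \<Gamma> a b"
| join: "swept \<delta> \<Gamma> a b \<Longrightarrow> swept \<delta> \<Gamma> b c \<Longrightarrow> swept \<delta> \<Gamma> a c"

lemma swept_less: "swept \<delta> \<Gamma> a b \<Longrightarrow> a < b"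
  by (induction rule: swept.induct) auto

lemma chart_sweep_cong:
  assumes "chart_sweep \<delta> \<Gamma> a b" "\<delta>' \<le> \<delta>"
    and "\<And>w t. w \<in> cball 0 \<delta>' \<Longrightarrow> t \<in> {a..b} \<Longrightarrow> \<Gamma>' w t = \<Gamma> w t"
  shows "chart_sweep \<delta>' \<Gamma>' a b"
proof -
  have sub: "cball 0 \<delta>' \<subseteq> cball (0::complex) \<delta>" using assms(2) by auto
  then have sub': "cball 0 \<delta>' \<times> {a..b} \<subseteq> cball (0::complex) \<delta> \<times> {a..b}" by blast
  from assms(1) obtain U \<phi> g g' c where *: "(U, \<phi>) \<in> A" "c > 0"
    "continuous_on (cball 0 \<delta> \<times> {a..b}) (\<lambda>(w, t). g w t)"
    "continuous_on (cball 0 \<delta> \<times> {a..b}) (\<lambda>(w, t). g' w t)"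
    "\<forall>w\<in>cball 0 \<delta>. \<forall>t\<in>{a..b}. \<Gamma> w t = inv_into U \<phi> (g w t) \<and> g w t \<in> \<phi> ` (U \<inter> B\<^sub>0) \<and>
        (g w has_vector_derivative g' w t) (at t within {a..b})"
    "\<forall>t\<in>{a..b}. \<forall>w\<in>cball 0 \<delta>. \<forall>w'\<in>cball 0 \<delta>. c * norm (w - w') \<le> norm (g w t - g w' t)"
    unfolding chart_sweep_def by blast
  have cont: "continuous_on (cball 0 \<delta>' \<times> {a..b}) (\<lambda>(w, t). g w t)"
    "continuous_on (cball 0 \<delta>' \<times> {a..b}) (\<lambda>(w, t). g' w t)"
    by (rule continuous_on_subset[OF *(3) sub'], rule continuous_on_subset[OF *(4) sub'])
  have "\<forall>w\<in>cball 0 \<delta>'. \<forall>t\<in>{a..b}. \<Gamma>' w t = inv_into U \<phi> (g w t) \<and> g w t \<in> \<phi> ` (U \<inter> B\<^sub>0) \<and>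
        (g w has_vector_derivative g' w t) (at t within {a..b})"
    using *(5) assms(3) sub by (simp add: subset_iff)
  moreover have "\<forall>t\<in>{a..b}. \<forall>w\<in>cball 0 \<delta>'. \<forall>w'\<in>cball 0 \<delta>'. c * norm (w - w') \<le> norm (g w t - g w' t)"
    using *(6) sub by (simp add: subset_iff)
  ultimately show ?thesis unfolding chart_sweep_def using *(1,2) cont by blast
qed

lemma swept_cong:
  assumes "swept \<delta> \<Gamma> a b" "\<delta>' \<le> \<delta>"
    and "\<And>w t. w \<in> cball 0 \<delta>' \<Longrightarrow> t \<in> {a..b} \<Longrightarrow> \<Gamma>' w t = \<Gamma> w t"
  shows "swept \<delta>' \<Gamma>' a b"
  using assms(1,3)
proof (induction rule: swept.induct)
  case (piece a b)
  then show ?case using chart_sweep_cong[OF piece(2) assms(2)] by (blast intro: swept.piece)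
next
  case (join a b c)
  have "a < b" "b < c" using join(1,2) swept_less by blast+
  then have "swept \<delta>' \<Gamma>' a b" "swept \<delta>' \<Gamma>' b c"
    by (intro join.IH join.prems; simp)+
  then show ?case by (rule swept.join)
qed

lemma continuous_on_swept:
  assumes "swept \<delta> \<Gamma> a b"
  shows "continuous_on (cball 0 \<delta> \<times> {a..b}) (\<lambda>(w, t). \<Gamma> w t)"
    and "\<And>w t. w \<in> cball 0 \<delta> \<Longrightarrow> t \<in> {a..b} \<Longrightarrow> \<Gamma> w t \<in> B\<^sub>0"
proof -
  have "continuous_on (cball 0 \<delta> \<times> {a..b}) (\<lambda>(w, t). \<Gamma> w t) \<and>
      (\<forall>w\<in>cball 0 \<delta>. \<forall>t\<in>{a..b}. \<Gamma> w t \<in> B\<^sub>0)"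
    using assms
  proof (induction rule: swept.induct)
    case (piece a b)
    then obtain U \<phi> g where U: "(U, \<phi>) \<in> A"
      and g: "continuous_on (cball 0 \<delta> \<times> {a..b}) (\<lambda>(w, t). g w t)"
      and \<Gamma>: "\<forall>w\<in>cball 0 \<delta>. \<forall>t\<in>{a..b}. \<Gamma> w t = inv_into U \<phi> (g w t) \<and> g w t \<in> \<phi> ` (U \<inter> B\<^sub>0)"
      unfolding chart_sweep_def by blast
    have in_B0: "\<Gamma> w t \<in> B\<^sub>0" if "w \<in> cball 0 \<delta>" "t \<in> {a..b}" for w t
    proof -
      have eq: "\<Gamma> w t = inv_into U \<phi> (g w t)" and mem: "g w t \<in> \<phi> ` (U \<inter> B\<^sub>0)"
        using \<Gamma> that by blast+
      show ?thesis unfolding eq using chart_inv(1)[OF U mem Int_lower1] by blast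
    qed
    have inv: "continuous_on (\<phi> ` U) (inv_into U \<phi>)" using chart(3)[OF U] by (simp add: homeomorphism_def)
    have "continuous_on (cball 0 \<delta> \<times> {a..b}) (\<lambda>x. inv_into U \<phi> (case x of (w, t) \<Rightarrow> g w t))"
    proof (rule continuous_on_compose2[OF inv g])
      show "(\<lambda>(w, t). g w t) ` (cball 0 \<delta> \<times> {a..b}) \<subseteq> \<phi> ` U"
      proof (rule image_subsetI)
        fix x :: "complex \<times> real" assume "x \<in> cball 0 \<delta> \<times> {a..b}"
        then obtain w t where x: "x = (w, t)" "w \<in> cball 0 \<delta>" "t \<in> {a..b}" by blast
        then have "g w t \<in> \<phi> ` (U \<inter> B\<^sub>0)" using \<Gamma> by blast
        then show "(case x of (w, t) \<Rightarrow> g w t) \<in> \<phi> ` U" unfolding x(1) prod.case by blast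
      qed
    qed
    then have "continuous_on (cball 0 \<delta> \<times> {a..b}) (\<lambda>(w, t). \<Gamma> w t)"
      by (rule continuous_on_eq) (use \<Gamma> in auto)
    then show ?case using in_B0 by blast
  next
    case (join a b c)
    have "a < b" "b < c" using join(1,2) swept_less by blast+
    then have Un: "{a..c} = {a..b} \<union> {b..c}" by auto
    have "continuous_on ((cball 0 \<delta> \<times> {a..b}) \<union> (cball 0 \<delta> \<times> {b..c})) (\<lambda>(w, t). \<Gamma> w t)"
      using join.IH by (intro continuous_on_closed_Un closed_Times) auto
    then show ?case using join.IH unfolding Un by (auto simp: Sigma_Un_distrib2)
  qed
  then show "continuous_on (cball 0 \<delta> \<times> {a..b}) (\<lambda>(w, t). \<Gamma> w t)"
    and "\<And>w t. w \<in> cball 0 \<delta> \<Longrightarrow> t \<in> {a..b} \<Longrightarrow> \<Gamma> w t \<in> B\<^sub>0" by blast+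
qed

lemma admissible_arc_mono:
  assumes "admissible_arc S a b \<gamma> L" "L \<le> L'"
  shows "admissible_arc S a b \<gamma> L'"
proof -
  have "set_nn_integral lborel {a..b} h \<le> L'" if "set_nn_integral lborel {a..b} h \<le> L" for h
    using that assms(2) by (rule order_trans)
  then show ?thesis using assms(1) unfolding admissible_arc_def by blast
qed

text \<open>
  The majorants of the two arcs are added after restriction to their intervals; at the common point
  \<open>b\<close> both are present, which only enlarges the majorant.
\<close>

lemma admissible_arc_join:
  assumes 1: "admissible_arc S a b \<gamma> L1" and 2: "admissible_arc S b c \<gamma> L2"
    and less: "a < b" "b < c"
  shows "admissible_arc S a c \<gamma> (L1 + L2)"
  unfolding admissible_arc_def
proof (intro conjI)
  have Un: "{a..c} = {a..b} \<union> {b..c}" using less by auto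
  show "\<gamma> ` {a..c} \<subseteq> B\<^sub>0 - S"
    using 1 2 unfolding admissible_arc_def Un image_Un by blast
  let ?C1 = "C1_curve_on (restrict_atlas (B\<^sub>0 - S) A)"
  obtain n p where p: "p 0 = a" "p n = b" "\<And>i. i < n \<Longrightarrow> p i < p (Suc i) \<and> ?C1 (p i) (p (Suc i)) \<gamma>"
    using 1 unfolding admissible_arc_def by blast
  obtain m q where q: "q 0 = b" "q m = c" "\<And>i. i < m \<Longrightarrow> q i < q (Suc i) \<and> ?C1 (q i) (q (Suc i)) \<gamma>"
    using 2 unfolding admissible_arc_def by blast
  define r where "r i = (if i < n then p i else q (i - n))" for i
  have "r i < r (Suc i) \<and> ?C1 (r i) (r (Suc i)) \<gamma>" if "i < n + m" for i
  proof (cases "i < n")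
    case True
    then have "r i = p i" "r (Suc i) = p (Suc i)"
      using p(2) q(1) by (auto simp: r_def) (metis Suc_lessI diff_self_eq_0)
    then show ?thesis using p(3)[OF True] by simp
  next
    case False
    then have "r i = q (i - n)" "r (Suc i) = q (Suc (i - n))" by (auto simp: r_def Suc_diff_le)
    then show ?thesis using q(3)[of "i - n"] that False by simp
  qed
  moreover have "r 0 = a" using p(1,2) q(1) by (auto simp: r_def)
  moreover have "r (n + m) = c" using q(2) by (simp add: r_def)
  ultimately show "\<exists>n (p :: nat \<Rightarrow> real). p 0 = a \<and> p n = c \<and> (\<forall>i<n. p i < p (Suc i) \<and> ?C1 (p i) (p (Suc i)) \<gamma>)"
    by blast
  let ?\<kappa> = "\<lambda>t. kobayashi_royden (B\<^sub>0 - S) (restrict_atlas (B\<^sub>0 - S) A) (\<gamma> t)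
             (velocity (restrict_atlas (B\<^sub>0 - S) A) \<gamma> t)"
  obtain h1 where h1: "h1 \<in> borel_measurable borel" "AE t in lborel. t \<in> {a..b} \<longrightarrow> ?\<kappa> t \<le> h1 t"
      "(\<integral>\<^sup>+ t\<in>{a..b}. h1 t \<partial>lborel) \<le> L1"
    using 1 unfolding admissible_arc_def by blast
  obtain h2 where h2: "h2 \<in> borel_measurable borel" "AE t in lborel. t \<in> {b..c} \<longrightarrow> ?\<kappa> t \<le> h2 t"
      "(\<integral>\<^sup>+ t\<in>{b..c}. h2 t \<partial>lborel) \<le> L2"
    using 2 unfolding admissible_arc_def by blast
  define h where "h t = h1 t * indicator {a..b} t + h2 t * indicator {b..c} t" for t
  have m: "(\<lambda>t. h1 t * indicator {a..b} t) \<in> borel_measurable borel"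
    "(\<lambda>t. h2 t * indicator {b..c} t) \<in> borel_measurable borel"
    using h1(1) h2(1) by (auto intro!: borel_measurable_times_ennreal borel_measurable_indicator)
  have "h \<in> borel_measurable borel"
    unfolding h_def using m by (rule borel_measurable_add)
  moreover have "AE t in lborel. t \<in> {a..c} \<longrightarrow> ?\<kappa> t \<le> h t"
    using h1(2) h2(2)
  proof eventually_elim
    case (elim t)
    then show ?case unfolding Un h_def by (auto simp: indicator_def intro: add_increasing add_increasing2)
  qed
  moreover have "(\<integral>\<^sup>+ t\<in>{a..c}. h t \<partial>lborel) \<le> L1 + L2"
  proof -
    have "(\<integral>\<^sup>+ t\<in>{a..c}. h t \<partial>lborel) \<le> (\<integral>\<^sup>+ t. h t \<partial>lborel)"
      by (intro nn_integral_mono) (auto simp: indicator_def)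
    also have "\<dots> = (\<integral>\<^sup>+ t\<in>{a..b}. h1 t \<partial>lborel) + (\<integral>\<^sup>+ t\<in>{b..c}. h2 t \<partial>lborel)"
      unfolding h_def using m by (intro nn_integral_add) auto
    also have "\<dots> \<le> L1 + L2" by (intro add_mono h1(3) h2(3))
    finally show ?thesis .
  qed
  ultimately show "\<exists>h. h \<in> borel_measurable borel \<and> (AE t in lborel. t \<in> {a..c} \<longrightarrow> ?\<kappa> t \<le> h t) \<and>
      (\<integral>\<^sup>+ t\<in>{a..c}. h t \<partial>lborel) \<le> L1 + L2" by blast
qed

lemma short_on_average_join:
  assumes 1: "short_on_average \<delta> \<Gamma> a b" and 2: "short_on_average \<delta> \<Gamma> b c" and less: "a < b" "b < c"
  shows "short_on_average \<delta> \<Gamma> a c"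
proof -
  let ?good = "\<lambda>C a b S s \<Phi>. \<Phi> \<in> borel_measurable borel \<and>
        (\<integral>\<^sup>+ w\<in>cball 0 \<delta>. \<Phi> w \<partial>lborel) \<le> ennreal (C * sqrt (real (s + 1))) \<and>
        (\<forall>w\<in>cball 0 \<delta>. \<Phi> w < top \<longrightarrow> admissible_arc S a b (\<Gamma> w) (\<Phi> w))"
  obtain C1 where C1: "C1 \<ge> 0" "\<And>S s. finite S \<and> S \<subseteq> B\<^sub>0 \<and> card S \<le> s \<Longrightarrow> \<exists>\<Phi>. ?good C1 a b S s \<Phi>"
    using 1 unfolding short_on_average_def by blast
  obtain C2 where C2: "C2 \<ge> 0" "\<And>S s. finite S \<and> S \<subseteq> B\<^sub>0 \<and> card S \<le> s \<Longrightarrow> \<exists>\<Phi>. ?good C2 b c S s \<Phi>"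
    using 2 unfolding short_on_average_def by blast
  have "\<exists>\<Phi>. ?good (C1 + C2) a c S s \<Phi>" if S: "finite S \<and> S \<subseteq> B\<^sub>0 \<and> card S \<le> s" for S s
  proof -
    obtain \<Phi>1 where \<Phi>1: "?good C1 a b S s \<Phi>1" using C1(2)[OF S] by blast
    obtain \<Phi>2 where \<Phi>2: "?good C2 b c S s \<Phi>2" using C2(2)[OF S] by blast
    have m: "(\<lambda>w. \<Phi>1 w * indicator (cball 0 \<delta>) w) \<in> borel_measurable borel"
      "(\<lambda>w. \<Phi>2 w * indicator (cball 0 \<delta>) w) \<in> borel_measurable borel"
      using \<Phi>1 \<Phi>2 by (auto intro!: borel_measurable_times_ennreal borel_measurable_indicator)
    have "(\<integral>\<^sup>+ w\<in>cball 0 \<delta>. (\<Phi>1 w + \<Phi>2 w) \<partial>lborel)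
        = (\<integral>\<^sup>+ w\<in>cball 0 \<delta>. \<Phi>1 w \<partial>lborel) + (\<integral>\<^sup>+ w\<in>cball 0 \<delta>. \<Phi>2 w \<partial>lborel)"
      unfolding distrib_right using m by (intro nn_integral_add) auto
    also have "\<dots> \<le> ennreal (C1 * sqrt (real (s + 1))) + ennreal (C2 * sqrt (real (s + 1)))"
      using \<Phi>1 \<Phi>2 by (intro add_mono) auto
    also have "\<dots> = ennreal ((C1 + C2) * sqrt (real (s + 1)))"
      using C1(1) C2(1) by (simp add: distrib_right)
    finally have "(\<integral>\<^sup>+ w\<in>cball 0 \<delta>. (\<Phi>1 w + \<Phi>2 w) \<partial>lborel) \<le> ennreal ((C1 + C2) * sqrt (real (s + 1)))" .
    moreover have "admissible_arc S a c (\<Gamma> w) (\<Phi>1 w + \<Phi>2 w)"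
      if "w \<in> cball 0 \<delta>" "\<Phi>1 w + \<Phi>2 w < top" for w
      using that \<Phi>1 \<Phi>2 by (intro admissible_arc_join[OF _ _ less]) auto
    moreover have "(\<lambda>w. \<Phi>1 w + \<Phi>2 w) \<in> borel_measurable borel"
      using \<Phi>1 \<Phi>2 by (intro borel_measurable_add) auto
    ultimately show ?thesis by (intro exI[of _ "\<lambda>w. \<Phi>1 w + \<Phi>2 w"]) blast
  qed
  then show ?thesis unfolding short_on_average_def using C1(1) C2(1)
    by (intro exI[of _ "C1 + C2"]) simp
qed

lemma short_on_average_swept:
  assumes "swept \<delta> \<Gamma> a b" "\<delta> > 0" "0 \<le> a" "b \<le> 1"
  shows "short_on_average \<delta> \<Gamma> a b"
  using assms(1,3,4)
proof (induction rule: swept.induct)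
  case (piece a b)
  then show ?case using short_on_average_chart_sweep assms(2) by blast
next
  case (join a b c)
  have less: "a < b" "b < c" using join(1,2) swept_less by blast+
  show ?case
    by (rule short_on_average_join[OF _ _ less]) (use join less in auto)
qed

text \<open>
  A bound that holds on average is attained, up to a factor, by some member; the summand \<open>1\<close> in the
  factor \<open>(C0 + 1) / V\<close> (with \<open>V\<close> the area of the disk) makes the comparison strict and the constant
  positive.
\<close>

lemma exists_short_member:
  assumes avg: "short_on_average \<delta> \<Gamma> a b" and \<delta>: "\<delta> > 0"
  shows "\<exists>C>0. \<forall>S s. finite S \<and> S \<subseteq> B\<^sub>0 \<and> card S \<le> s \<longrightarrow>
     (\<exists>w\<in>cball 0 \<delta>. admissible_arc S a b (\<Gamma> w) (ennreal (C * sqrt (real (s + 1)))))"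
proof -
  obtain C0 where C0: "C0 \<ge> 0" "\<And>S s. finite S \<and> S \<subseteq> B\<^sub>0 \<and> card S \<le> s \<Longrightarrow> \<exists>\<Phi>. \<Phi> \<in> borel_measurable borel \<and>
        (\<integral>\<^sup>+ w\<in>cball 0 \<delta>. \<Phi> w \<partial>lborel) \<le> ennreal (C0 * sqrt (real (s + 1))) \<and>
        (\<forall>w\<in>cball 0 \<delta>. \<Phi> w < top \<longrightarrow> admissible_arc S a b (\<Gamma> w) (\<Phi> w))"
    using avg unfolding short_on_average_def by blast
  define V where "V = pi * \<delta>\<^sup>2"
  have V: "V > 0" "emeasure lborel (cball (0::complex) \<delta>) = ennreal V"
    using \<delta> by (simp_all add: V_def emeasure_cball unit_ball_vol_2)
  define C where "C = (C0 + 1) / V"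
  have C: "C > 0" using C0(1) V(1) by (simp add: C_def)
  have "\<exists>w\<in>cball 0 \<delta>. admissible_arc S a b (\<Gamma> w) (ennreal (C * sqrt (real (s + 1))))"
    if S: "finite S \<and> S \<subseteq> B\<^sub>0 \<and> card S \<le> s" for S s
  proof -
    let ?L = "ennreal (C * sqrt (real (s + 1)))"
    obtain \<Phi> where \<Phi>: "\<Phi> \<in> borel_measurable borel"
        "(\<integral>\<^sup>+ w\<in>cball 0 \<delta>. \<Phi> w \<partial>lborel) \<le> ennreal (C0 * sqrt (real (s + 1)))"
        "\<And>w. w \<in> cball 0 \<delta> \<Longrightarrow> \<Phi> w < top \<Longrightarrow> admissible_arc S a b (\<Gamma> w) (\<Phi> w)"
      using C0(2)[OF S] by blast
    have "\<exists>w\<in>cball 0 \<delta>. \<Phi> w \<le> ?L"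
    proof (rule ccontr)
      assume "\<not> ?thesis"
      then have below: "?L * indicator (cball 0 \<delta>) w \<le> \<Phi> w * indicator (cball 0 \<delta>) w" for w
        by (cases "w \<in> cball 0 \<delta>") (auto simp: not_le intro: less_imp_le)
      have "?L * ennreal V = (\<integral>\<^sup>+ w\<in>cball (0::complex) \<delta>. ?L \<partial>lborel)"
        unfolding V(2)[symmetric] by (rule nn_integral_cmult_indicator[symmetric]) simp
      also have "\<dots> \<le> (\<integral>\<^sup>+ w\<in>cball 0 \<delta>. \<Phi> w \<partial>lborel)"
        by (intro nn_integral_mono below)
      also note \<Phi>(2)
      also have "?L * ennreal V = ennreal (C * sqrt (real (s + 1)) * V)"
        using C V(1) by (intro ennreal_mult[symmetric]) auto
      also have "C * sqrt (real (s + 1)) * V = (C0 + 1) * sqrt (real (s + 1))"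
        using V(1) by (simp add: C_def)
      finally have "(C0 + 1) * sqrt (real (s + 1)) \<le> C0 * sqrt (real (s + 1))"
        using C0(1) by (simp add: ennreal_le_iff)
      then show False by (simp add: distrib_right)
    qed
    then obtain w where w: "w \<in> cball 0 \<delta>" "\<Phi> w \<le> ?L" by blast
    then have "\<Phi> w < top" using ennreal_less_top le_less_trans by blast
    then show ?thesis using w \<Phi>(3) admissible_arc_mono by blast
  qed
  then show ?thesis using C by blast
qed

end


section \<open>Interpolation between germs of biholomorphic maps\<close>

text \<open>
  The derivative of \<open>k - deriv k 0 * id\<close> vanishes at \<open>0\<close> and is continuous, hence it is small near
  \<open>0\<close>.
\<close>

lemma nearly_linear:
  fixes k :: "complex \<Rightarrow> complex"
  assumes k: "k holomorphic_on ball 0 \<delta>0" and pos: "\<delta>0 > 0" "\<epsilon> > 0"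
  obtains \<delta> where "\<delta> > 0" "\<delta> < \<delta>0"
    "\<And>w w'. w \<in> cball 0 \<delta> \<Longrightarrow> w' \<in> cball 0 \<delta> \<Longrightarrow>
       norm ((k w - deriv k 0 * w) - (k w' - deriv k 0 * w')) \<le> \<epsilon> * norm (w - w')"
proof -
  have "continuous_on (ball 0 \<delta>0) (deriv k)"
    by (intro holomorphic_on_imp_continuous_on holomorphic_deriv k) auto
  then have "continuous (at 0) (deriv k)"
    using pos by (simp add: continuous_on_eq_continuous_at)
  then obtain d where d: "d > 0" "\<And>w. dist w 0 < d \<Longrightarrow> dist (deriv k w) (deriv k 0) < \<epsilon>"
    using pos(2) unfolding continuous_at_eps_delta by blast
  define \<delta> where "\<delta> = min d \<delta>0 / 2"
  have \<delta>: "\<delta> > 0" "\<delta> < \<delta>0" "\<delta> < d" using d(1) pos by (auto simp: \<delta>_def)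
  show thesis
  proof (rule that[OF \<delta>(1,2)])
    fix w w' :: complex assume w: "w \<in> cball 0 \<delta>" "w' \<in> cball 0 \<delta>"
    show "norm ((k w - deriv k 0 * w) - (k w' - deriv k 0 * w')) \<le> \<epsilon> * norm (w - w')"
    proof (rule field_differentiable_bound[where S = "cball 0 \<delta>" and f' = "\<lambda>w. deriv k w - deriv k 0"])
      fix z :: complex assume z: "z \<in> cball 0 \<delta>"
      then have "(k has_field_derivative deriv k z) (at z)"
        using \<delta>(2) by (intro holomorphic_derivI[OF k]) auto
      then have "((\<lambda>w. k w - deriv k 0 * w) has_field_derivative deriv k z - deriv k 0) (at z)"
        by (auto intro!: derivative_eq_intros)
      then show "((\<lambda>w. k w - deriv k 0 * w) has_field_derivative deriv k z - deriv k 0) (at z within cball 0 \<delta>)"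
        by (rule has_field_derivative_at_within)
      show "norm (deriv k z - deriv k 0) \<le> \<epsilon>"
        using d(2)[of z] z \<delta>(3) by (simp add: dist_norm)
    qed (use w in auto)
  qed
qed

text \<open>
  With \<open>exp \<mu>0\<close> and \<open>exp \<mu>1\<close> the derivatives at \<open>0\<close>, the linear part \<open>exp (\<mu>0 + \<tau> * (\<mu>1 - \<mu>0))\<close>
  runs from the one to the other without vanishing, even if the segment between them contains \<open>0\<close>,
  and its modulus stays above a constant \<open>m\<close>. The remainders \<open>h0\<close>, \<open>h1\<close> have Lipschitz constant
  \<open>m / 2\<close> near \<open>0\<close>, and so has their convex combination; what is left of the expansion is \<open>m / 2\<close>.
\<close>

lemma interpolate_germs:
  fixes k0 k1 :: "complex \<Rightarrow> complex" and a b \<eta> :: real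
  assumes k0: "k0 holomorphic_on ball 0 \<delta>0" "k0 0 = 0" "deriv k0 0 \<noteq> 0"
    and k1: "k1 holomorphic_on ball 0 \<delta>0" "k1 0 = 0" "deriv k1 0 \<noteq> 0"
    and pos: "\<delta>0 > 0" "\<eta> > 0" and ab: "a < b"
  obtains \<delta> c E E' where "\<delta> > 0" "\<delta> < \<delta>0" "c > 0"
    "continuous_on (cball 0 \<delta> \<times> {a..b}) (\<lambda>(w, t). E w t)"
    "continuous_on (cball 0 \<delta> \<times> {a..b}) (\<lambda>(w, t). E' w t)"
    "\<And>w t. (E w has_vector_derivative E' w t) (at t within {a..b})"
    "\<And>w. E w a = k0 w" "\<And>w. E w b = k1 w" "\<And>t. E 0 t = 0"
    "\<And>w t. w \<in> cball 0 \<delta> \<Longrightarrow> t \<in> {a..b} \<Longrightarrow> norm (E w t) < \<eta>"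
    "\<And>w w' t. w \<in> cball 0 \<delta> \<Longrightarrow> w' \<in> cball 0 \<delta> \<Longrightarrow> t \<in> {a..b} \<Longrightarrow>
       c * norm (w - w') \<le> norm (E w t - E w' t)"
proof -
  obtain \<mu>0 where \<mu>0: "exp \<mu>0 = deriv k0 0" using k0(3) by (metis exp_Ln)
  obtain \<mu>1 where \<mu>1: "exp \<mu>1 = deriv k1 0" using k1(3) by (metis exp_Ln)
  define m M where "m = exp (min (Re \<mu>0) (Re \<mu>1))" and "M = exp (max (Re \<mu>0) (Re \<mu>1))"
  have mM: "m > 0" "M > 0" by (simp_all add: m_def M_def)
  define h0 where "h0 w = k0 w - deriv k0 0 * w" for w
  define h1 where "h1 w = k1 w - deriv k1 0 * w" for w
  obtain \<delta>1 where \<delta>1: "\<delta>1 > 0" "\<delta>1 < \<delta>0"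
    "\<And>w w'. w \<in> cball 0 \<delta>1 \<Longrightarrow> w' \<in> cball 0 \<delta>1 \<Longrightarrow> norm (h0 w - h0 w') \<le> m / 2 * norm (w - w')"
    using nearly_linear[OF k0(1) pos(1), of "m / 2"] mM unfolding h0_def by (metis half_gt_zero)
  obtain \<delta>2 where \<delta>2: "\<delta>2 > 0" "\<delta>2 < \<delta>0"
    "\<And>w w'. w \<in> cball 0 \<delta>2 \<Longrightarrow> w' \<in> cball 0 \<delta>2 \<Longrightarrow> norm (h1 w - h1 w') \<le> m / 2 * norm (w - w')"
    using nearly_linear[OF k1(1) pos(1), of "m / 2"] mM unfolding h1_def by (metis half_gt_zero)
  \<comment> \<open>The last term serves the bound \<open>norm (E w t) \<le> (M + m) * norm w\<close>.\<close>
  define \<delta> where "\<delta> = min (min \<delta>1 \<delta>2) (\<eta> / (2 * (M + m)))"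
  have \<delta>: "\<delta> > 0" "\<delta> \<le> \<delta>1" "\<delta> \<le> \<delta>2" "\<delta> < \<delta>0" "(M + m) * \<delta> < \<eta>"
  proof -
    show "\<delta> > 0" "\<delta> \<le> \<delta>1" "\<delta> \<le> \<delta>2" "\<delta> < \<delta>0" using \<delta>1 \<delta>2 pos mM by (auto simp: \<delta>_def)
    have "(M + m) * \<delta> \<le> (M + m) * (\<eta> / (2 * (M + m)))"
      using mM by (intro mult_left_mono) (auto simp: \<delta>_def)
    also have "\<dots> = \<eta> / 2" using mM by (simp add: field_simps)
    finally show "(M + m) * \<delta> < \<eta>" using pos by simp
  qed
  define \<tau> where "\<tau> t = (t - a) / (b - a)" for t :: real
  define \<Lambda> where "\<Lambda> t = exp (\<mu>0 + of_real (\<tau> t) * (\<mu>1 - \<mu>0))" for t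
  define R where "R w t = of_real (1 - \<tau> t) * h0 w + of_real (\<tau> t) * h1 w" for w t
  define E where "E w t = \<Lambda> t * w + R w t" for w t
  define E' where "E' w t = (\<Lambda> t * (\<mu>1 - \<mu>0) * w + (h1 w - h0 w)) * of_real (1 / (b - a))" for w t
  have \<tau>: "0 \<le> \<tau> t" "\<tau> t \<le> 1" if "t \<in> {a..b}" for t
    using that ab by (auto simp: \<tau>_def)
  have \<tau>_ends: "\<tau> a = 0" "\<tau> b = 1" using ab by (auto simp: \<tau>_def)
  have \<Lambda>_norm: "m \<le> norm (\<Lambda> t)" "norm (\<Lambda> t) \<le> M" if "t \<in> {a..b}" for t
  proof -
    have Re: "norm (\<Lambda> t) = exp ((1 - \<tau> t) * Re \<mu>0 + \<tau> t * Re \<mu>1)"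
      by (simp add: \<Lambda>_def algebra_simps)
    have "(1 - \<tau> t) * min (Re \<mu>0) (Re \<mu>1) + \<tau> t * min (Re \<mu>0) (Re \<mu>1) \<le> (1 - \<tau> t) * Re \<mu>0 + \<tau> t * Re \<mu>1"
      using \<tau>[OF that] by (intro add_mono mult_left_mono) auto
    then show "m \<le> norm (\<Lambda> t)" unfolding Re m_def by (simp add: algebra_simps)
    have "(1 - \<tau> t) * Re \<mu>0 + \<tau> t * Re \<mu>1 \<le> (1 - \<tau> t) * max (Re \<mu>0) (Re \<mu>1) + \<tau> t * max (Re \<mu>0) (Re \<mu>1)"
      using \<tau>[OF that] by (intro add_mono mult_left_mono) auto
    then show "norm (\<Lambda> t) \<le> M" unfolding Re M_def by (simp add: algebra_simps)
  qed
  have R_lip: "norm (R w t - R w' t) \<le> m / 2 * norm (w - w')"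
    if w: "w \<in> cball 0 \<delta>" "w' \<in> cball 0 \<delta>" and t: "t \<in> {a..b}" for w w' t
  proof -
    have "R w t - R w' t = of_real (1 - \<tau> t) * (h0 w - h0 w') + of_real (\<tau> t) * (h1 w - h1 w')"
      by (simp add: R_def algebra_simps)
    also have "norm \<dots> \<le> (1 - \<tau> t) * norm (h0 w - h0 w') + \<tau> t * norm (h1 w - h1 w')"
      using \<tau>[OF t] by (intro norm_triangle_le) (simp add: norm_mult del: of_real_diff)
    also have "\<dots> \<le> (1 - \<tau> t) * (m / 2 * norm (w - w')) + \<tau> t * (m / 2 * norm (w - w'))"
      using \<tau>[OF t] w \<delta>(2,3) by (intro add_mono mult_left_mono \<delta>1(3) \<delta>2(3)) auto
    also have "\<dots> = m / 2 * norm (w - w')" unfolding distrib_right[symmetric] by simp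
    finally show ?thesis .
  qed
  have hol: "h0 holomorphic_on ball 0 \<delta>0" "h1 holomorphic_on ball 0 \<delta>0"
    unfolding h0_def h1_def using k0(1) k1(1) by (auto intro!: holomorphic_intros)
  have sub: "cball 0 \<delta> \<subseteq> ball (0::complex) \<delta>0" using \<delta>(4) by auto
  have cont_h: "continuous_on (cball 0 \<delta> \<times> {a..b}) (\<lambda>x. h0 (fst x))"
    "continuous_on (cball 0 \<delta> \<times> {a..b}) (\<lambda>x. h1 (fst x))"
    using sub
    by (auto intro!: continuous_on_compose2[OF holomorphic_on_imp_continuous_on[OF hol(1)]]
        continuous_on_compose2[OF holomorphic_on_imp_continuous_on[OF hol(2)]] continuous_intros)
  have zero: "R 0 t = 0" for t by (simp add: R_def h0_def h1_def k0 k1)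
  show thesis
  proof (rule that[of \<delta> "m / 2" E E'])
    show "continuous_on (cball 0 \<delta> \<times> {a..b}) (\<lambda>(w, t). E w t)"
      unfolding E_def R_def \<Lambda>_def \<tau>_def split_beta using ab
      by (intro continuous_intros cont_h) auto
    show "continuous_on (cball 0 \<delta> \<times> {a..b}) (\<lambda>(w, t). E' w t)"
      unfolding E'_def \<Lambda>_def \<tau>_def split_beta using ab
      by (intro continuous_intros cont_h) auto
    show "(E w has_vector_derivative E' w t) (at t within {a..b})" for w t
    proof -
      have \<tau>': "((\<lambda>t. complex_of_real (\<tau> t)) has_vector_derivative of_real (1 / (b - a))) (at t within {a..b})"
        unfolding \<tau>_def using ab
        by (intro has_vector_derivative_of_real) (auto intro!: derivative_eq_intros)
      have "((\<lambda>z. exp (\<mu>0 + z * (\<mu>1 - \<mu>0)) * w + ((1 - z) * h0 w + z * h1 w)) has_field_derivative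
          \<Lambda> t * (\<mu>1 - \<mu>0) * w + (h1 w - h0 w)) (at (of_real (\<tau> t)))"
        unfolding \<Lambda>_def by (auto intro!: derivative_eq_intros simp: algebra_simps)
      then have "(((\<lambda>z. exp (\<mu>0 + z * (\<mu>1 - \<mu>0)) * w + ((1 - z) * h0 w + z * h1 w)) \<circ> (\<lambda>t. complex_of_real (\<tau> t)))
          has_vector_derivative of_real (1 / (b - a)) * (\<Lambda> t * (\<mu>1 - \<mu>0) * w + (h1 w - h0 w))) (at t within {a..b})"
        by (rule field_vector_diff_chain_within[OF \<tau>' has_field_derivative_at_within])
      then show ?thesis
        by (simp add: comp_def E_def[abs_def] R_def \<Lambda>_def E'_def mult.commute)
    qed
    show "E w a = k0 w" "E w b = k1 w" for w
      by (simp_all add: E_def R_def \<Lambda>_def \<tau>_ends h0_def h1_def \<mu>0 \<mu>1)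
    show "E 0 t = 0" for t by (simp add: E_def zero)
    show "norm (E w t) < \<eta>" if w: "w \<in> cball 0 \<delta>" and t: "t \<in> {a..b}" for w t
    proof -
      have "norm (E w t) \<le> norm (\<Lambda> t) * norm w + norm (R w t)"
        unfolding E_def using norm_triangle_ineq[of "\<Lambda> t * w" "R w t"] by (simp add: norm_mult)
      also have "\<dots> \<le> M * norm w + m / 2 * norm w"
        using R_lip[OF w _ t, of 0] \<delta>(1) \<Lambda>_norm(2)[OF t] by (intro add_mono mult_right_mono) (auto simp: zero)
      also have "\<dots> \<le> (M + m) * norm w" using mM by (simp add: algebra_simps)
      also have "\<dots> \<le> (M + m) * \<delta>" using w mM by (intro mult_left_mono) auto
      also note \<delta>(5)
      finally show ?thesis .
    qed
    show "m / 2 * norm (w - w') \<le> norm (E w t - E w' t)"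
      if w: "w \<in> cball 0 \<delta>" "w' \<in> cball 0 \<delta>" and t: "t \<in> {a..b}" for w w' t
    proof -
      have "m * norm (w - w') \<le> norm (\<Lambda> t) * norm (w - w')"
        using \<Lambda>_norm(1)[OF t] by (intro mult_right_mono) auto
      also have "\<dots> = norm ((E w t - E w' t) - (R w t - R w' t))"
        unfolding E_def by (simp add: norm_mult[symmetric] algebra_simps)
      also have "\<dots> \<le> norm (E w t - E w' t) + norm (R w t - R w' t)" by (rule norm_triangle_ineq4)
      also have "\<dots> \<le> norm (E w t - E w' t) + m / 2 * norm (w - w')" using R_lip[OF w t] by simp
      finally show ?thesis by simp
    qed
  qed (use \<delta> mM in auto)
qed


section \<open>Families of loops around a given loop\<close>

context open_part_of_surface
begin

text \<open>
  Germs at \<open>x\<close> of injective holomorphic parametrisations of a neighbourhood. All charts at \<open>x\<close> are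
  mentioned because the two pieces of the family that meet at a point use different charts there.
\<close>

definition local_parameter :: "(complex \<Rightarrow> 'a) \<Rightarrow> 'a \<Rightarrow> bool" where
  "local_parameter e x \<longleftrightarrow> e 0 = x \<and> (\<forall>(U, \<phi>)\<in>A. x \<in> U \<longrightarrow>
     (\<exists>\<delta>>0. e ` ball 0 \<delta> \<subseteq> U \<and> (\<phi> \<circ> e) holomorphic_on ball 0 \<delta> \<and> deriv (\<phi> \<circ> e) 0 \<noteq> 0))"

lemma chart_exists:
  assumes "x \<in> B"
  obtains U \<phi> where "(U, \<phi>) \<in> A" "x \<in> U"
proof -
  have "(\<Union>(U, \<phi>)\<in>A. U) = B" using surface unfolding riemann_surface_def by (elim conjE)
  then have "x \<in> (\<Union>(U, \<phi>)\<in>A. U)" using assms by (simp only:)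
  then show thesis using that by auto
qed

lemma local_parameter_exists:
  assumes "x \<in> B"
  shows "\<exists>e. local_parameter e x"
proof -
  obtain U \<phi> where U: "(U, \<phi>) \<in> A" "x \<in> U" using chart_exists[OF assms] .
  define e where "e w = inv_into U \<phi> (\<phi> x + w)" for w
  have "\<exists>\<delta>>0. e ` ball 0 \<delta> \<subseteq> V \<and> (\<psi> \<circ> e) holomorphic_on ball 0 \<delta> \<and> deriv (\<psi> \<circ> e) 0 \<noteq> 0"
    if V: "(V, \<psi>) \<in> A" "x \<in> V" for V \<psi>
  proof -
    have "\<phi> x \<in> \<phi> ` (U \<inter> V)" using U(2) V(2) by blast
    then obtain \<delta> where \<delta>: "\<delta> > 0" "ball (\<phi> x) \<delta> \<subseteq> \<phi> ` (U \<inter> V)"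
      using open_chart_overlap[OF U(1) V(1)] unfolding open_contains_ball by blast
    have mem: "\<phi> x + w \<in> \<phi> ` (U \<inter> V)" if "w \<in> ball 0 \<delta>" for w
    proof -
      have "\<phi> x + w \<in> ball (\<phi> x) \<delta>" using that by (simp add: dist_norm)
      then show ?thesis using \<delta>(2) by blast
    qed
    have e: "e w \<in> U \<inter> V" "\<phi> (e w) = \<phi> x + w" if "w \<in> ball 0 \<delta>" for w
      unfolding e_def by (rule chart_inv[OF U(1) mem[OF that] Int_lower1])+
    have "((\<psi> \<circ> inv_into U \<phi>) \<circ> (\<lambda>w. \<phi> x + w)) holomorphic_on ball 0 \<delta>"
    proof (rule holomorphic_on_compose_gen[OF _ holomorphic_transition[OF U(1) V(1)]])
      show "(\<lambda>w. \<phi> x + w) ` ball 0 \<delta> \<subseteq> \<phi> ` (U \<inter> V)" using mem by blast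
    qed (intro holomorphic_intros)
    then have hol: "(\<psi> \<circ> e) holomorphic_on ball 0 \<delta>" by (simp add: e_def comp_def)
    have inj: "inj_on (\<psi> \<circ> e) (ball 0 \<delta>)"
    proof (rule inj_onI)
      fix w w' assume w: "w \<in> ball 0 \<delta>" "w' \<in> ball 0 \<delta>" and eq: "(\<psi> \<circ> e) w = (\<psi> \<circ> e) w'"
      have in_V: "e w \<in> V" "e w' \<in> V" using e(1)[OF w(1)] e(1)[OF w(2)] by blast+
      have "inv_into V \<psi> (\<psi> (e w)) = inv_into V \<psi> (\<psi> (e w'))" using eq by (simp only: comp_apply)
      then have "e w = e w'" unfolding inv_chart[OF V(1) in_V(1)] inv_chart[OF V(1) in_V(2)] .
      then have "\<phi> (e w) = \<phi> (e w')" by (rule arg_cong)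
      then show "w = w'" unfolding e(2)[OF w(1)] e(2)[OF w(2)] by (rule add_left_imp_eq)
    qed
    have "deriv (\<psi> \<circ> e) 0 \<noteq> 0"
      by (rule holomorphic_injective_imp_regular[OF hol open_ball inj]) (simp add: \<delta>(1))
    moreover have "e ` ball 0 \<delta> \<subseteq> V" using e(1) by blast
    ultimately show ?thesis using \<delta>(1) hol by blast
  qed
  moreover have "e 0 = x" unfolding e_def add_0_right by (rule inv_chart[OF U])
  ultimately show ?thesis unfolding local_parameter_def by blast
qed

lemma local_parameter_coordinate:
  assumes e: "local_parameter e x" and U: "(U, \<phi>) \<in> A" "x \<in> U"
  obtains \<delta> where "\<delta> > 0" "e ` ball 0 \<delta> \<subseteq> U" "(\<lambda>w. \<phi> (e w) - \<phi> x) holomorphic_on ball 0 \<delta>"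
    "\<phi> (e 0) - \<phi> x = 0" "deriv (\<lambda>w. \<phi> (e w) - \<phi> x) 0 \<noteq> 0"
proof -
  obtain \<delta> where \<delta>: "\<delta> > 0" "e ` ball 0 \<delta> \<subseteq> U" "(\<phi> \<circ> e) holomorphic_on ball 0 \<delta>" "deriv (\<phi> \<circ> e) 0 \<noteq> 0"
    using e U unfolding local_parameter_def by blast
  have hol: "(\<lambda>w. \<phi> (e w)) holomorphic_on ball 0 \<delta>" using \<delta>(3) by (simp add: comp_def)
  have "(\<lambda>w. \<phi> (e w)) field_differentiable at 0"
    using hol \<delta>(1) by (simp add: holomorphic_on_imp_differentiable_at)
  then have "deriv (\<lambda>w. \<phi> (e w) - \<phi> x) 0 = deriv (\<phi> \<circ> e) 0"
    by (simp add: comp_def)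
  moreover have "\<phi> (e 0) - \<phi> x = 0" using e by (simp add: local_parameter_def)
  ultimately show thesis
    using that[OF \<delta>(1,2)] hol \<delta>(4) by (simp add: holomorphic_intros)
qed

text \<open>
  In the chart the family is the translate of the curve \<open>\<phi> \<circ> \<alpha>\<close> by an interpolation of the germs of
  the parameters at the end points; translations do not affect the expansion in \<open>w\<close>.
\<close>

lemma chart_sweep_exists:
  assumes U: "(U, \<phi>) \<in> A" and ab: "a < b"
    and C1: "C1_curve_on (restrict_atlas B\<^sub>0 A) a b \<alpha>"
    and \<alpha>: "\<And>t. t \<in> {a..b} \<Longrightarrow> \<alpha> t \<in> U \<inter> B\<^sub>0"
    and e0: "local_parameter e0 (\<alpha> a)" and e1: "local_parameter e1 (\<alpha> b)"
  obtains \<delta> \<Gamma> where "\<delta> > 0" "chart_sweep \<delta> \<Gamma> a b"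
    "\<And>w. w \<in> cball 0 \<delta> \<Longrightarrow> \<Gamma> w a = e0 w \<and> \<Gamma> w b = e1 w" "\<And>t. t \<in> {a..b} \<Longrightarrow> \<Gamma> 0 t = \<alpha> t"
proof -
  have "(U \<inter> B\<^sub>0, \<phi>) \<in> restrict_atlas B\<^sub>0 A" using U unfolding restrict_atlas_def by force
  from bspec[OF C1[unfolded C1_curve_on_def] this]
  obtain v where v: "continuous_on {t\<in>{a..b}. \<alpha> t \<in> U \<inter> B\<^sub>0} v"
    "\<forall>t\<in>{a..b}. \<alpha> t \<in> U \<inter> B\<^sub>0 \<longrightarrow> ((\<phi> \<circ> \<alpha>) has_vector_derivative v t) (at t within {a..b})" by auto
  have "{t\<in>{a..b}. \<alpha> t \<in> U \<inter> B\<^sub>0} = {a..b}" using \<alpha> by blast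
  then have v_cont: "continuous_on {a..b} v" using v(1) by simp
  define f where "f t = \<phi> (\<alpha> t)" for t
  have f_der: "(f has_vector_derivative v t) (at t within {a..b})" if "t \<in> {a..b}" for t
    using v(2) \<alpha>[OF that] that unfolding f_def comp_def by blast
  have f_cont: "continuous_on {a..b} f"
    by (rule continuous_on_vector_derivative) (rule f_der)
  obtain \<eta> where \<eta>: "\<eta> > 0" "(\<Union>z\<in>f ` {a..b}. ball z \<eta>) \<subseteq> \<phi> ` (U \<inter> B\<^sub>0)"
  proof (rule compact_subset_open_imp_ball_epsilon_subset)
    show "compact (f ` {a..b})" by (intro compact_continuous_image f_cont) simp
    show "open (\<phi> ` (U \<inter> B\<^sub>0))" by (rule open_chart_image[OF U open_part])
    show "f ` {a..b} \<subseteq> \<phi> ` (U \<inter> B\<^sub>0)" using \<alpha> unfolding f_def by blast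
  qed
  define k0 where "k0 w = \<phi> (e0 w) - f a" for w
  define k1 where "k1 w = \<phi> (e1 w) - f b" for w
  have "\<alpha> a \<in> U" "\<alpha> b \<in> U" using \<alpha> ab by auto
  obtain d0 where d0: "d0 > 0" "e0 ` ball 0 d0 \<subseteq> U" "k0 holomorphic_on ball 0 d0" "k0 0 = 0" "deriv k0 0 \<noteq> 0"
    using local_parameter_coordinate[OF e0 U \<open>\<alpha> a \<in> U\<close>] unfolding k0_def f_def by blast
  obtain d1 where d1: "d1 > 0" "e1 ` ball 0 d1 \<subseteq> U" "k1 holomorphic_on ball 0 d1" "k1 0 = 0" "deriv k1 0 \<noteq> 0"
    using local_parameter_coordinate[OF e1 U \<open>\<alpha> b \<in> U\<close>] unfolding k1_def f_def by blast
  define d where "d = min d0 d1"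
  have d: "d > 0" "ball (0::complex) d \<subseteq> ball 0 d0" "ball (0::complex) d \<subseteq> ball 0 d1"
    using d0(1) d1(1) by (auto simp: d_def)
  obtain \<delta> c E E' where \<delta>: "\<delta> > 0" "\<delta> < d" and c: "c > 0"
    and E: "continuous_on (cball 0 \<delta> \<times> {a..b}) (\<lambda>(w, t). E w t)"
    and E': "continuous_on (cball 0 \<delta> \<times> {a..b}) (\<lambda>(w, t). E' w t)"
    and E_der: "\<And>w t. (E w has_vector_derivative E' w t) (at t within {a..b})"
    and E_ends: "\<And>w. E w a = k0 w" "\<And>w. E w b = k1 w" "\<And>t. E 0 t = 0"
    and E_small: "\<And>w t. w \<in> cball 0 \<delta> \<Longrightarrow> t \<in> {a..b} \<Longrightarrow> norm (E w t) < \<eta>"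
    and E_lower: "\<And>w w' t. w \<in> cball 0 \<delta> \<Longrightarrow> w' \<in> cball 0 \<delta> \<Longrightarrow> t \<in> {a..b} \<Longrightarrow>
       c * norm (w - w') \<le> norm (E w t - E w' t)"
    using interpolate_germs[OF holomorphic_on_subset[OF d0(3) d(2)] d0(4,5)
        holomorphic_on_subset[OF d1(3) d(3)] d1(4,5) d(1) \<eta>(1) ab] by blast
  define \<Gamma> where "\<Gamma> w t = inv_into U \<phi> (f t + E w t)" for w t
  have "chart_sweep \<delta> \<Gamma> a b"
    unfolding chart_sweep_def
  proof (intro exI conjI ballI)
    show "(U, \<phi>) \<in> A" "c > 0" by fact+
    have "continuous_on (cball (0::complex) \<delta> \<times> {a..b}) (\<lambda>x. f (snd x))"
      by (rule continuous_on_compose2[OF f_cont]) (auto intro!: continuous_intros)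
    then show "continuous_on (cball 0 \<delta> \<times> {a..b}) (\<lambda>(w, t). f t + E w t)"
      using E unfolding split_beta by (intro continuous_on_add)
    have "continuous_on (cball (0::complex) \<delta> \<times> {a..b}) (\<lambda>x. v (snd x))"
      by (rule continuous_on_compose2[OF v_cont]) (auto intro!: continuous_intros)
    then show "continuous_on (cball 0 \<delta> \<times> {a..b}) (\<lambda>(w, t). v t + E' w t)"
      using E' unfolding split_beta by (intro continuous_on_add)
  next
    fix w :: complex and t assume w: "w \<in> cball 0 \<delta>" and t: "t \<in> {a..b}"
    show "\<Gamma> w t = inv_into U \<phi> (f t + E w t)" by (simp add: \<Gamma>_def)
    have "f t + E w t \<in> ball (f t) \<eta>" using E_small[OF w t] by (simp add: dist_norm)
    then show "f t + E w t \<in> \<phi> ` (U \<inter> B\<^sub>0)" using \<eta>(2) t by blast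
    show "((\<lambda>t. f t + E w t) has_vector_derivative v t + E' w t) (at t within {a..b})"
      by (intro has_vector_derivative_add f_der E_der t)
  next
    fix t and w w' :: complex assume "t \<in> {a..b}" "w \<in> cball 0 \<delta>" "w' \<in> cball 0 \<delta>"
    then show "c * norm (w - w') \<le> norm ((f t + E w t) - (f t + E w' t))"
      using E_lower by simp
  qed
  moreover have "\<Gamma> w a = e0 w \<and> \<Gamma> w b = e1 w" if w: "w \<in> cball 0 \<delta>" for w
  proof -
    have "w \<in> ball 0 d" using w \<delta>(2) by simp
    then have "e0 w \<in> U" "e1 w \<in> U" using d0(2) d1(2) d(2,3) by blast+
    then show ?thesis
      using inv_chart[OF U] by (simp add: \<Gamma>_def E_ends k0_def k1_def)
  qed
  moreover have "\<Gamma> 0 t = \<alpha> t" if "t \<in> {a..b}" for t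
    using inv_chart[OF U] \<alpha>[OF that] by (simp add: \<Gamma>_def E_ends f_def)
  ultimately show thesis using that \<delta>(1) by blast
qed

text \<open>
  The quantification over all parameters at both ends makes the property transitive: a parameter at
  an intermediate point may be chosen freely and prescribed on both sides.
\<close>

definition sweepable :: "(real \<Rightarrow> 'a) \<Rightarrow> real \<Rightarrow> real \<Rightarrow> bool" where
  "sweepable \<alpha> a b \<longleftrightarrow> (\<forall>e0 e1. local_parameter e0 (\<alpha> a) \<longrightarrow> local_parameter e1 (\<alpha> b) \<longrightarrow>
     (\<exists>\<delta>>0. \<exists>\<Gamma>. swept \<delta> \<Gamma> a b \<and> (\<forall>w\<in>cball 0 \<delta>. \<Gamma> w a = e0 w \<and> \<Gamma> w b = e1 w) \<and>
        (\<forall>t\<in>{a..b}. \<Gamma> 0 t = \<alpha> t)))"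

lemma sweepable_join:
  assumes 1: "sweepable \<alpha> a b" and 2: "sweepable \<alpha> b c" and b: "\<alpha> b \<in> B" and less: "a < b" "b < c"
  shows "sweepable \<alpha> a c"
  unfolding sweepable_def
proof (intro allI impI)
  fix e0 e2 assume e0: "local_parameter e0 (\<alpha> a)" and e2: "local_parameter e2 (\<alpha> c)"
  obtain e1 where e1: "local_parameter e1 (\<alpha> b)" using local_parameter_exists[OF b] by blast
  obtain \<delta>1 \<Gamma>1 where \<Gamma>1: "\<delta>1 > 0" "swept \<delta>1 \<Gamma>1 a b"
    "\<And>w. w \<in> cball 0 \<delta>1 \<Longrightarrow> \<Gamma>1 w a = e0 w \<and> \<Gamma>1 w b = e1 w" "\<And>t. t \<in> {a..b} \<Longrightarrow> \<Gamma>1 0 t = \<alpha> t"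
    using 1 e0 e1 unfolding sweepable_def by blast
  obtain \<delta>2 \<Gamma>2 where \<Gamma>2: "\<delta>2 > 0" "swept \<delta>2 \<Gamma>2 b c"
    "\<And>w. w \<in> cball 0 \<delta>2 \<Longrightarrow> \<Gamma>2 w b = e1 w \<and> \<Gamma>2 w c = e2 w" "\<And>t. t \<in> {b..c} \<Longrightarrow> \<Gamma>2 0 t = \<alpha> t"
    using 2 e1 e2 unfolding sweepable_def by blast
  define \<delta> where "\<delta> = min \<delta>1 \<delta>2"
  define \<Gamma> where "\<Gamma> w t = (if t \<le> b then \<Gamma>1 w t else \<Gamma>2 w t)" for w t
  have \<delta>: "\<delta> > 0" "\<delta> \<le> \<delta>1" "\<delta> \<le> \<delta>2" using \<Gamma>1(1) \<Gamma>2(1) by (auto simp: \<delta>_def)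
  have sub: "w \<in> cball 0 \<delta>1" "w \<in> cball 0 \<delta>2" if "w \<in> cball 0 \<delta>" for w :: complex
    using that \<delta> by auto
  \<comment> \<open>At \<open>t = b\<close> the two families agree, having the same parameter \<open>e1\<close> there.\<close>
  have eq2: "\<Gamma> w t = \<Gamma>2 w t" if w: "w \<in> cball 0 \<delta>" and t: "t \<in> {b..c}" for w t
  proof (cases "t = b")
    case True
    then show ?thesis using \<Gamma>1(3)[OF sub(1)[OF w]] \<Gamma>2(3)[OF sub(2)[OF w]] by (simp add: \<Gamma>_def)
  qed (use t in \<open>simp add: \<Gamma>_def\<close>)
  have "swept \<delta> \<Gamma> a b" by (rule swept_cong[OF \<Gamma>1(2) \<delta>(2)]) (simp add: \<Gamma>_def)
  moreover have "swept \<delta> \<Gamma> b c" by (rule swept_cong[OF \<Gamma>2(2) \<delta>(3) eq2])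
  ultimately have "swept \<delta> \<Gamma> a c" by (rule swept.join)
  moreover have "\<Gamma> w a = e0 w \<and> \<Gamma> w c = e2 w" if w: "w \<in> cball 0 \<delta>" for w
    using \<Gamma>1(3)[OF sub(1)[OF w]] \<Gamma>2(3)[OF sub(2)[OF w]] less by (simp add: \<Gamma>_def)
  moreover have "\<Gamma> 0 t = \<alpha> t" if "t \<in> {a..c}" for t
    using \<Gamma>1(4)[of t] \<Gamma>2(4)[of t] that by (simp add: \<Gamma>_def)
  ultimately show "\<exists>\<delta>>0. \<exists>\<Gamma>. swept \<delta> \<Gamma> a c \<and> (\<forall>w\<in>cball 0 \<delta>. \<Gamma> w a = e0 w \<and> \<Gamma> w c = e2 w) \<and>
        (\<forall>t\<in>{a..c}. \<Gamma> 0 t = \<alpha> t)"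
    using \<delta>(1) by blast
qed

lemma C1_curve_on_subinterval:
  assumes "C1_curve_on A' a b \<gamma>" "{c..d} \<subseteq> {a..b}"
  shows "C1_curve_on A' c d \<gamma>"
  unfolding C1_curve_on_def
proof
  fix x assume x: "x \<in> A'"
  obtain U \<phi> where U: "x = (U, \<phi>)" by (cases x)
  obtain v where v: "continuous_on {t\<in>{a..b}. \<gamma> t \<in> U} v"
    "\<forall>t\<in>{a..b}. \<gamma> t \<in> U \<longrightarrow> ((\<phi> \<circ> \<gamma>) has_vector_derivative v t) (at t within {a..b})"
    using bspec[OF assms(1)[unfolded C1_curve_on_def] x] unfolding U prod.case by blast
  have "continuous_on {t\<in>{c..d}. \<gamma> t \<in> U} v"
    by (rule continuous_on_subset[OF v(1)]) (use assms(2) in blast)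
  moreover have "((\<phi> \<circ> \<gamma>) has_vector_derivative v t) (at t within {c..d})" if "t \<in> {c..d}" "\<gamma> t \<in> U" for t
  proof (rule has_vector_derivative_within_subset[OF _ assms(2)])
    have "t \<in> {a..b}" using that(1) assms(2) by blast
    then show "((\<phi> \<circ> \<gamma>) has_vector_derivative v t) (at t within {a..b})" using v(2) that(2) by blast
  qed
  ultimately show "case x of (U, \<phi>) \<Rightarrow> \<exists>v. continuous_on {t\<in>{c..d}. \<gamma> t \<in> U} v \<and>
      (\<forall>t\<in>{c..d}. \<gamma> t \<in> U \<longrightarrow> ((\<phi> \<circ> \<gamma>) has_vector_derivative v t) (at t within {c..d}))"
    unfolding U prod.case by blast
qed

text \<open>
  By transitivity the property only has to be checked on short intervals around each point, and
  these are mapped into a single chart.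
\<close>

lemma sweepable_C1_curve:
  assumes C1: "C1_curve_on (restrict_atlas B\<^sub>0 A) lo hi \<alpha>" and less: "lo < hi"
    and cont: "continuous_on {lo..hi} \<alpha>" and \<alpha>: "\<alpha> ` {lo..hi} \<subseteq> B\<^sub>0"
  shows "sweepable \<alpha> lo hi"
proof -
  have B0_B: "B\<^sub>0 \<subseteq> B" using open_part by (rule openin_imp_subset)
  define P where "P a b \<longleftrightarrow> (lo \<le> a \<longrightarrow> b \<le> hi \<longrightarrow> a < b \<longrightarrow> sweepable \<alpha> a b)" for a b
  have "lo \<le> hi" using less by simp
  then have "P lo hi"
  proof (induction rule: Bolzano)
    case (trans a b c)
    show ?case
      unfolding P_def
    proof (intro impI)
      assume *: "lo \<le> a" "c \<le> hi" "a < c"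
      show "sweepable \<alpha> a c"
      proof (cases "a = b \<or> b = c")
        case True
        then show ?thesis using trans * by (auto simp: P_def)
      next
        case False
        then have ab: "a < b" "b < c" using trans(3,4) by auto
        have "b \<in> {lo..hi}" using * trans(3,4) by simp
        then have b: "\<alpha> b \<in> B" using \<alpha> B0_B by blast
        have "sweepable \<alpha> a b" "sweepable \<alpha> b c" using trans(1,2) * ab by (auto simp: P_def)
        then show ?thesis by (rule sweepable_join[where \<alpha> = \<alpha> and b = b, OF _ _ b ab])
      qed
    qed
  next
    case (local x)
    then have x: "x \<in> {lo..hi}" by simp
    then have "\<alpha> x \<in> B" using \<alpha> B0_B by blast
    then obtain U \<phi> where U: "(U, \<phi>) \<in> A" "\<alpha> x \<in> U" using chart_exists by blast
    obtain W where W: "open W" "U = B \<inter> W" using chart(1)[OF U(1)] unfolding openin_open by blast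
    have "openin (top_of_set {lo..hi}) ({lo..hi} \<inter> \<alpha> -` W)"
      by (rule continuous_openin_preimage_gen[OF cont W(1)])
    then obtain d where d: "d > 0" "\<And>t. t \<in> {lo..hi} \<Longrightarrow> dist t x < d \<Longrightarrow> \<alpha> t \<in> W"
      using x U(2) W(2) unfolding openin_euclidean_subtopology_iff by blast
    have "P a b" if ab: "a \<le> x" "x \<le> b" "b - a < d" for a b
      unfolding P_def
    proof (intro impI)
      assume *: "lo \<le> a" "b \<le> hi" "a < b"
      have sub: "{a..b} \<subseteq> {lo..hi}" using * by auto
      have in_U: "\<alpha> t \<in> U \<inter> B\<^sub>0" if "t \<in> {a..b}" for t
      proof -
        have "t \<in> {lo..hi}" using that sub by blast
        moreover have "dist t x < d" using that ab by (auto simp: dist_real_def)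
        ultimately show ?thesis using d(2) \<alpha> B0_B W(2) by blast
      qed
      show "sweepable \<alpha> a b"
        unfolding sweepable_def
      proof (intro allI impI)
        fix e0 e1 assume e: "local_parameter e0 (\<alpha> a)" "local_parameter e1 (\<alpha> b)"
        obtain \<delta> \<Gamma> where "\<delta> > 0" "chart_sweep \<delta> \<Gamma> a b"
          "\<And>w. w \<in> cball 0 \<delta> \<Longrightarrow> \<Gamma> w a = e0 w \<and> \<Gamma> w b = e1 w" "\<And>t. t \<in> {a..b} \<Longrightarrow> \<Gamma> 0 t = \<alpha> t"
          using chart_sweep_exists[OF U(1) *(3) C1_curve_on_subinterval[OF C1 sub] in_U e] by blast
        then show "\<exists>\<delta>>0. \<exists>\<Gamma>. swept \<delta> \<Gamma> a b \<and> (\<forall>w\<in>cball 0 \<delta>. \<Gamma> w a = e0 w \<and> \<Gamma> w b = e1 w) \<and>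
            (\<forall>t\<in>{a..b}. \<Gamma> 0 t = \<alpha> t)"
          using swept.piece[OF *(3)] by blast
      qed
    qed
    then show ?case using d(1) by blast
  qed
  then show ?thesis using less by (simp add: P_def)
qed

lemma sweepable_path:
  assumes "pw_C1_path B\<^sub>0 (restrict_atlas B\<^sub>0 A) \<alpha>"
  shows "sweepable \<alpha> 0 1"
proof -
  obtain n p where p: "p 0 = 0" "p n = 1"
    "\<And>i. i < n \<Longrightarrow> p i < p (Suc i) \<and> C1_curve_on (restrict_atlas B\<^sub>0 A) (p i) (p (Suc i)) \<alpha>"
    and cont: "continuous_on {0..1} \<alpha>" and \<alpha>: "\<alpha> ` {0..1} \<subseteq> B\<^sub>0"
    using assms unfolding pw_C1_path_def path_def path_image_def by blast
  have mono: "p i \<le> p j" if "i \<le> j" "j \<le> n" for i j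
    using that
  proof (induction j)
    case (Suc j)
    then show ?case using p(3)[of j] by (cases "i = Suc j") auto
  qed simp
  have B0_B: "B\<^sub>0 \<subseteq> B" using open_part by (rule openin_imp_subset)
  have piece: "sweepable \<alpha> (p i) (p (Suc i))" if i: "i < n" for i
  proof -
    have sub: "{p i..p (Suc i)} \<subseteq> {0..1}" using mono[of 0 i] mono[of "Suc i" n] i p(1,2) by auto
    show ?thesis
      using p(3)[OF i] continuous_on_subset[OF cont sub] \<alpha> sub by (intro sweepable_C1_curve) blast+
  qed
  have "0 < i \<longrightarrow> sweepable \<alpha> 0 (p i)" if "i \<le> n" for i
    using that
  proof (induction i)
    case (Suc i)
    show ?case
    proof (cases "i = 0")
      case True
      then show ?thesis using piece[of 0] Suc.prems p(1) by simp
    next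
      case False
      have "p 0 < p 1" using p(3)[of 0] Suc.prems by simp
      then have pos: "0 < p i" using mono[of 1 i] False Suc.prems p(1) by simp
      have "p i \<in> {0..1}" using pos mono[of i n] Suc.prems p(2) by auto
      then have "\<alpha> (p i) \<in> B" using \<alpha> B0_B by blast
      moreover have "p i < p (Suc i)" "sweepable \<alpha> (p i) (p (Suc i))" "sweepable \<alpha> 0 (p i)"
        using p(3)[of i] piece[of i] Suc False by auto
      ultimately show ?thesis using sweepable_join pos by blast
    qed
  qed simp
  moreover have "0 < n" using p(1,2) by (cases n) auto
  ultimately show ?thesis using p(2) by fastforce
qed

text \<open>
  Contracting the parameter disk to its centre moves \<open>\<Gamma> w\<close> to \<open>\<Gamma> 0 = \<alpha>\<close> through loops in \<open>B\<^sub>0\<close>.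
\<close>

lemma homotopic_loops_swept:
  assumes swept: "swept \<delta> \<Gamma> 0 1" and closed: "\<And>w. w \<in> cball 0 \<delta> \<Longrightarrow> \<Gamma> w 1 = \<Gamma> w 0"
    and \<alpha>: "\<And>t. t \<in> {0..1} \<Longrightarrow> \<Gamma> 0 t = \<alpha> t" and w: "w \<in> cball 0 \<delta>"
  shows "homotopic_loops B\<^sub>0 (\<Gamma> w) \<alpha>"
  unfolding homotopic_loops
proof (intro exI conjI ballI)
  define h where "h = (\<lambda>x. \<Gamma> (of_real (1 - fst x) * w) (snd x))"
  have mem: "of_real (1 - u) * w \<in> cball 0 \<delta>" if "u \<in> {0..1}" for u :: real
  proof -
    have "norm (complex_of_real (1 - u) * w) = (1 - u) * norm w"
      unfolding norm_mult norm_of_real using that by simp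
    also have "\<dots> \<le> 1 * norm w" using that by (intro mult_right_mono) auto
    finally show ?thesis using w by simp
  qed
  have "continuous_on ({0..1} \<times> {0..1}) (\<lambda>x. case (of_real (1 - fst x) * w, snd x) of (w, t) \<Rightarrow> \<Gamma> w t)"
  proof (rule continuous_on_compose2[OF continuous_on_swept(1)[OF swept]])
    show "(\<lambda>x. (of_real (1 - fst x) * w, snd x)) ` ({0..1} \<times> {0..1}) \<subseteq> cball 0 \<delta> \<times> {0..1}"
      using mem by (intro image_subsetI) (simp add: mem_Times_iff)
  qed (intro continuous_intros)
  then show "continuous_on ({0..1} \<times> {0..1}) h" by (simp add: h_def)
  show "h \<in> {0..1} \<times> {0..1} \<rightarrow> B\<^sub>0"
    using continuous_on_swept(2)[OF swept mem] by (auto simp: h_def)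
  show "h (0, t) = \<Gamma> w t" "h (1, t) = \<alpha> t" if "t \<in> {0..1}" for t
    using \<alpha>[OF that] by (simp_all add: h_def)
  show "pathfinish (h \<circ> Pair u) = pathstart (h \<circ> Pair u)" if "u \<in> {0..1}" for u
    using closed[OF mem[OF that]] by (simp add: h_def pathfinish_def pathstart_def)
qed

text \<open>
  The family closes up to loops because the same local parameter \<open>e\<close> is prescribed at both ends of
  \<open>\<alpha>\<close>, so that \<open>\<Gamma> w 0 = e w = \<Gamma> w 1\<close>.
\<close>

lemma exists_short_homotopic_loop:
  assumes "pw_C1_loop B\<^sub>0 (restrict_atlas B\<^sub>0 A) \<alpha>"
  shows "\<exists>C>0. \<forall>S s. finite S \<and> S \<subseteq> B\<^sub>0 \<and> card S \<le> s \<longrightarrow>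
     (\<exists>\<gamma>\<in>homotopic_loop_class B\<^sub>0 A S \<alpha>. kr_length B\<^sub>0 A S \<gamma> \<le> ennreal (C * sqrt (real (s + 1))))"
proof -
  have path: "pw_C1_path B\<^sub>0 (restrict_atlas B\<^sub>0 A) \<alpha>" and ends: "\<alpha> 1 = \<alpha> 0"
    using assms by (simp_all add: pw_C1_loop_def pathfinish_def pathstart_def)
  have "\<alpha> 0 \<in> B\<^sub>0" using path by (auto simp: pw_C1_path_def path_image_def)
  then have "\<alpha> 0 \<in> B" using openin_imp_subset[OF open_part] by blast
  then obtain e where e: "local_parameter e (\<alpha> 0)" using local_parameter_exists by blast
  then have e': "local_parameter e (\<alpha> 1)" using ends by simp
  obtain \<delta> \<Gamma> where \<delta>: "\<delta> > 0" and swept: "swept \<delta> \<Gamma> 0 1"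
    and \<Gamma>: "\<And>w. w \<in> cball 0 \<delta> \<Longrightarrow> \<Gamma> w 0 = e w \<and> \<Gamma> w 1 = e w" "\<And>t. t \<in> {0..1} \<Longrightarrow> \<Gamma> 0 t = \<alpha> t"
    using sweepable_path[OF path] e e' unfolding sweepable_def by blast
  obtain C where C: "C > 0" "\<And>S s. finite S \<and> S \<subseteq> B\<^sub>0 \<and> card S \<le> s \<Longrightarrow>
     \<exists>w\<in>cball 0 \<delta>. admissible_arc S 0 1 (\<Gamma> w) (ennreal (C * sqrt (real (s + 1))))"
    using exists_short_member[OF short_on_average_swept[OF swept \<delta>] \<delta>] by force
  have "\<exists>\<gamma>\<in>homotopic_loop_class B\<^sub>0 A S \<alpha>. kr_length B\<^sub>0 A S \<gamma> \<le> ennreal (C * sqrt (real (s + 1)))"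
    if S: "finite S \<and> S \<subseteq> B\<^sub>0 \<and> card S \<le> s" for S s
  proof -
    obtain w where w: "w \<in> cball 0 \<delta>" and arc: "admissible_arc S 0 1 (\<Gamma> w) (ennreal (C * sqrt (real (s + 1))))"
      using C(2)[OF S] by blast
    have hom: "homotopic_loops B\<^sub>0 (\<Gamma> w) \<alpha>"
      using \<Gamma> by (intro homotopic_loops_swept[OF swept _ _ w]) auto
    have "path (\<Gamma> w)"
      using continuous_on_slice(2)[OF continuous_on_swept(1)[OF swept] w] by (simp add: path_def)
    then have "pw_C1_loop (B\<^sub>0 - S) (restrict_atlas (B\<^sub>0 - S) A) (\<Gamma> w)"
      using arc \<Gamma>(1)[OF w]
      by (simp add: pw_C1_loop_def pw_C1_path_def admissible_arc_def path_image_def pathfinish_def pathstart_def)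
    then have "\<Gamma> w \<in> homotopic_loop_class B\<^sub>0 A S \<alpha>"
      using hom by (simp add: homotopic_loop_class_def)
    moreover have "kr_length B\<^sub>0 A S (\<Gamma> w) \<le> ennreal (C * sqrt (real (s + 1)))"
    proof -
      let ?\<kappa> = "\<lambda>t. kobayashi_royden (B\<^sub>0 - S) (restrict_atlas (B\<^sub>0 - S) A) (\<Gamma> w t)
             (velocity (restrict_atlas (B\<^sub>0 - S) A) (\<Gamma> w) t)"
      obtain h where h: "AE t in lborel. t \<in> {0..1} \<longrightarrow> ?\<kappa> t \<le> h t"
        "(\<integral>\<^sup>+ t\<in>{0..1}. h t \<partial>lborel) \<le> ennreal (C * sqrt (real (s + 1)))"
        using arc unfolding admissible_arc_def by blast
      have "kr_length B\<^sub>0 A S (\<Gamma> w) = (\<integral>\<^sup>+ t\<in>{0..1}. ?\<kappa> t \<partial>lborel)"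
        by (simp add: kr_length_def Let_def)
      also have "\<dots> \<le> (\<integral>\<^sup>+ t\<in>{0..1}. h t \<partial>lborel)"
        by (rule nn_integral_mono_AE) (use h(1) in \<open>eventually_elim, auto simp: indicator_def\<close>)
      finally show ?thesis using h(2) by (rule order_trans)
    qed
    ultimately show ?thesis by blast
  qed
  then show ?thesis using C(1) by blast
qed

end


section \<open>The bound for the maximal minimal length\<close>

theorem theorem1p5:
  fixes B B\<^sub>0 :: "'a::t2_space set" and A :: "'a chart set"
    and \<rho> :: "'a \<Rightarrow> 'a tangent \<Rightarrow> 'a tangent \<Rightarrow> real"
    and t :: nat and D :: "nat \<Rightarrow> 'a set"
    and b\<^sub>0 :: 'a and \<alpha> :: "real \<Rightarrow> 'a"
  assumes "riemann_surface B A" and "compact B"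
    and "riemannian_metric B A \<rho>"
    and "t \<ge> 1"
    and "\<forall>i\<in>{1..t}. closed_disk B A (D i)"
    and "disjoint_family_on D {1..t}"
    and "B\<^sub>0 = B - (\<Union>i\<in>{1..t}. D i)"
    and "b\<^sub>0 \<in> B\<^sub>0"
    and "pw_C1_loop B\<^sub>0 (restrict_atlas B\<^sub>0 A) \<alpha>" and "pathstart \<alpha> = b\<^sub>0"
    and "\<not> homotopic_paths B\<^sub>0 \<alpha> (\<lambda>_. b\<^sub>0)"
  shows "\<exists>C>0. \<forall>s::nat.
    max_min_length B\<^sub>0 A \<alpha> s \<le> ennreal (C * sqrt (real (s + 1) * ln (real (s + 2))))"
proof -
  have "closedin (top_of_set B) (\<Union>i\<in>{1..t}. D i)"
    using assms(5) by (intro closedin_Union) (auto simp: closed_disk_def)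
  then have "openin (top_of_set B) B\<^sub>0"
    unfolding assms(7) using openin_diff[OF openin_subtopology_self] by auto
  then interpret open_part_of_surface B B\<^sub>0 A
    using assms(1) by unfold_locales
  obtain C where C: "C > 0" "\<And>S s. finite S \<and> S \<subseteq> B\<^sub>0 \<and> card S \<le> s \<Longrightarrow>
     \<exists>\<gamma>\<in>homotopic_loop_class B\<^sub>0 A S \<alpha>. kr_length B\<^sub>0 A S \<gamma> \<le> ennreal (C * sqrt (real (s + 1)))"
    using exists_short_homotopic_loop[OF assms(9)] by blast
  have ln2: "ln (2::real) > 0" by simp
  have "max_min_length B\<^sub>0 A \<alpha> s \<le> ennreal (C / sqrt (ln 2) * sqrt (real (s + 1) * ln (real (s + 2))))" for s
    unfolding max_min_length_def
  proof (rule SUP_least)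
    fix S assume "S \<in> {S. S \<subseteq> B\<^sub>0 \<and> finite S \<and> card S \<le> s}"
    then obtain \<gamma> where \<gamma>: "\<gamma> \<in> homotopic_loop_class B\<^sub>0 A S \<alpha>"
      "kr_length B\<^sub>0 A S \<gamma> \<le> ennreal (C * sqrt (real (s + 1)))"
      using C(2)[of S s] by blast
    have "(INF \<gamma>\<in>homotopic_loop_class B\<^sub>0 A S \<alpha>. kr_length B\<^sub>0 A S \<gamma>) \<le> ennreal (C * sqrt (real (s + 1)))"
      by (rule INF_lower2[where f = "kr_length B\<^sub>0 A S", OF \<gamma>])
    also have "\<dots> \<le> ennreal (C / sqrt (ln 2) * sqrt (real (s + 1) * ln (real (s + 2))))"
    proof (rule ennreal_leI)
      have "C * sqrt (real (s + 1)) = C / sqrt (ln 2) * (sqrt (real (s + 1)) * sqrt (ln 2))"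
        using ln2 by simp
      also have "\<dots> \<le> C / sqrt (ln 2) * (sqrt (real (s + 1)) * sqrt (ln (real (s + 2))))"
        using C(1) ln2 by (intro mult_left_mono) auto
      finally show "C * sqrt (real (s + 1)) \<le> C / sqrt (ln 2) * sqrt (real (s + 1) * ln (real (s + 2)))"
        by (simp add: real_sqrt_mult)
    qed
    finally show "(INF \<gamma>\<in>homotopic_loop_class B\<^sub>0 A S \<alpha>. kr_length B\<^sub>0 A S \<gamma>)
        \<le> ennreal (C / sqrt (ln 2) * sqrt (real (s + 1) * ln (real (s + 2))))" .
  qed
  moreover have "C / sqrt (ln 2) > 0" using C(1) ln2 by simp
  ultimately show ?thesis by blast
qed

end
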